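(* Let $H$ be a fixed (non-empty, finite) directed acyclic graph and let $T_n$ be a random split tree with split vector $\mathcal V=(V_1,\dots,V_b)$ and $n$ balls (with fixed parameters $b,s,s_0,s_1$, $s_0\ge1$). Let $|A_0|=|A_0(H)|$ be the number of sink vertices of $H$ and $|A_1|=|A_1(H)|$ the number of ancestor vertices of $H$. Then there exist positive constants $c=c(H)$ and $c'=c'(H)$ (not depending on $n$) such that, for all large enough $n$, $$\mathbb E\big[[H]_{T_n}\big]\le c\,n^{|A_0|}(\ln n)^{|A_1|},$$ and with high probability $$[H]_{T_n}\ge c'\,n^{|A_0|}(\ln n)^{|A_1|}.$$
   Context: Split trees. Fix integers $b,s,s_0,s_1$ with $2\le b$, $0<s$, $0\le s_0\le s$, $0\le bs_1\le s+1-s_0$, and a random vector $\mathcal V=(V_1,\dots,V_b)$ of non-negative components with $\sum_iV_i=1$ (the split vector). Standing assumptions: the $V_i$ are identically distributed, $\mathbb P\{\exists i:V_i=1\}<1$, and $s_0\ge1$. All these parameters are fixed as $n\to\infty$ (constants may depend on them). The random split tree $T_n$ is built as follows. Take the infinite rooted $b$-ary tree $\mathcal U$; give each node $u$ an independent copy $\mathcal V_u=(V_{u,1},\dots,V_{u,b})$ of $\mathcal V$; let $C(u)$ be the number of balls in node $u$, initially $0$. A node $u$ is a leaf if $C(u)>0$ and $C(v)=0$ for all children $v$ of $u$, and internal if $C(v)>0$ for some proper descendant $v$. Balls $1,\dots,n$ are added one by one; ball $j$ is added thus: (1) put $j$ at the root; (2) while $j$ is at an internal node $u$, choose child $i$ with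 probability $V_{u,i}$ and move $j$ there; (3) if $j$ is at a leaf (or still empty node) $u$ with $C(u)<s$, it stays and $C(u)$ increases by $1$; if $C(u)=s$, the $s+1$ balls now at $u$ are redistributed: $s_0$ of them chosen uniformly at random stay at $u$; of the remaining $s+1-s_0$ balls, uniformly at random $s_1$ balls are given to each of the $b$ children; each of the remaining $s+1-s_0-bs_1$ balls goes independently to a child chosen according to $\mathcal V_u$; the splitting is repeated at any child receiving more than $s$ balls. After all $n$ balls are placed, delete all nodes whose subtree contains no balls. In $T_n$ every internal node contains exactly $s_0$ balls and every leaf between $1$ and $s$ balls. Order on balls: for balls $j_1,j_2$ in nodes $u_1,u_2$, $j_1<j_2$ iff $u_1$ is a proper ancestor of $u_2$; distinct balls in the same node are incomparable. A digraph here is a simple graph with a direction on each edge; it is acyclic if it has no directed cycle. An acyclic digraph $H$ induces a partial order on its vertices: $v<u$ if there is a directed path from $v$ to $u$; then $u$ is called a descendant of $v$. $[H]_{T_n}$ is the number of injective maps $\iota$ from $V(H)$ to the balls of $T_n$ such that $u<v$ in $H$ implies $\iota(u)<\iota(v)$ in the order on balls. A sink is a vertex of out-degree zero; $A_0(H)$ is the set of sinks. $A_1(H)$ (the "ancestor" vertices) is the set of non-sink vertices having exactly one descendant that is a sink. "With high probability" means with probability tending to $1$ as $n\to\infty$. *)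

theory Defs
  imports
    "HOL-Probability.Probability"
    "HOL-Library.Sublist"
    "Graph_Theory.Graph_Theory"
begin

section \<open>Random split trees\<close>

text \<open>
  A node of the infinite \<open>b\<close>-ary tree is the list of child indices in \<open>{..<b}\<close> that leads
  to it from the root \<open>[]\<close>; the children of \<open>u\<close> are \<open>u @ [i]\<close>, and the proper ancestors of \<open>u\<close>
  are its strict prefixes.

  After \<open>n\<close> insertions the tree is represented by a list \<open>xs\<close> of length \<open>n\<close>, where \<open>xs ! j\<close> is
  the node that contains ball \<open>j\<close> (balls are numbered from \<open>0\<close>). The nodes that survive the final
  deletion are the prefixes of the elements of \<open>xs\<close>.
\<close>

type_synonym node = "nat list"
type_synonym config = "node list"

definition balls_at :: "config \<Rightarrow> node \<Rightarrow> nat set" where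
  "balls_at xs u = {j. j < length xs \<and> xs ! j = u}"

definition ball_count :: "config \<Rightarrow> node \<Rightarrow> nat" where
  "ball_count xs u = card (balls_at xs u)"

definition internal :: "config \<Rightarrow> node \<Rightarrow> bool" where
  "internal xs u \<longleftrightarrow> (\<exists>v. strict_prefix u v \<and> ball_count xs v > 0)"

text \<open>
  In the following, \<open>w :: nat \<Rightarrow> real\<close> is the split vector of one node (only the components with
  index in \<open>{..<b}\<close> matter) and \<open>W u\<close> is the split vector of node \<open>u\<close>.
\<close>

text \<open>
  The guard \<open>i < b\<close> makes the function under \<open>embed_pmf\<close> a probability mass function whenever
  \<open>w\<close> is non-negative with sum \<open>1\<close> on \<open>{..<b}\<close>.
\<close>

definition child_pmf :: "nat \<Rightarrow> (nat \<Rightarrow> real) \<Rightarrow> nat pmf" where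
  "child_pmf b w = embed_pmf (\<lambda>i. if i < b then w i else 0)"

partial_function (spmf) route :: "nat \<Rightarrow> (node \<Rightarrow> nat \<Rightarrow> real) \<Rightarrow> config \<Rightarrow> node \<Rightarrow> node spmf" where
  "route b W xs u =
     (if internal xs u
      then bind_pmf (child_pmf b (W u)) (\<lambda>i. route b W xs (u @ [i]))
      else return_spmf u)"

text \<open>
  The ways of giving exactly \<open>s1\<close> of the balls in \<open>R\<close> to each of the \<open>b\<close> children: \<open>g j = Some i\<close>
  means that ball \<open>j\<close> is given to child \<open>i\<close>, and \<open>g j = None\<close> that it is not given to any child.
\<close>

definition allotments :: "nat \<Rightarrow> nat \<Rightarrow> nat set \<Rightarrow> (nat \<Rightarrow> nat option) set" where
  "allotments b s1 R =
     {g \<in> R \<rightarrow>\<^sub>E insert None (Some ` {..<b}). \<forall>i<b. card {j \<in> R. g j = Some i} = s1}"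

text \<open>
  Redistribution of the balls of node \<open>u\<close>: those in \<open>K\<close> are kept, \<open>g\<close> allots \<open>s1\<close> balls to each
  child, and \<open>h\<close> gives each of the other balls independently to a child chosen according to \<open>w\<close>.
\<close>

definition split_node ::
  "nat \<Rightarrow> nat \<Rightarrow> nat \<Rightarrow> (nat \<Rightarrow> real) \<Rightarrow> node \<Rightarrow> config \<Rightarrow> config pmf" where
  "split_node b s0 s1 w u xs =
     do {
       K \<leftarrow> pmf_of_set {K. K \<subseteq> balls_at xs u \<and> card K = s0};
       let R = balls_at xs u - K;
       g \<leftarrow> pmf_of_set (allotments b s1 R);
       h \<leftarrow> Pi_pmf {j \<in> R. g j = None} 0 (\<lambda>_. child_pmf b w);
       return_pmf
         (map (\<lambda>j. if j \<in> R then (case g j of Some i \<Rightarrow> u @ [i] | None \<Rightarrow> u @ [h j]) else xs ! j)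
           [0..<length xs])
     }"

text \<open>
  Splitting is repeated until no node holds more than \<open>s\<close> balls. When this is started by
  \<open>add_ball\<close>, at most one node is overfull at any time, so the choice operator is harmless.
  Both loops (\<open>route\<close> and \<open>settle\<close>) terminate if \<open>1 \<le> s0\<close>, so no mass is lost in the \<open>spmf\<close>.
\<close>

partial_function (spmf) settle ::
  "nat \<Rightarrow> nat \<Rightarrow> nat \<Rightarrow> nat \<Rightarrow> (node \<Rightarrow> nat \<Rightarrow> real) \<Rightarrow> config \<Rightarrow> config spmf" where
  "settle b s s0 s1 W xs =
     (if \<exists>u. ball_count xs u > s
      then let u = (SOME u. ball_count xs u > s)
           in bind_pmf (split_node b s0 s1 (W u) u xs) (settle b s s0 s1 W)
      else return_spmf xs)"

definition add_ball ::
  "nat \<Rightarrow> nat \<Rightarrow> nat \<Rightarrow> nat \<Rightarrow> (node \<Rightarrow> nat \<Rightarrow> real) \<Rightarrow> config \<Rightarrow> config spmf" where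
  "add_ball b s s0 s1 W xs =
     bind_spmf (route b W xs []) (\<lambda>u. settle b s s0 s1 W (xs @ [u]))"

primrec grow ::
  "nat \<Rightarrow> nat \<Rightarrow> nat \<Rightarrow> nat \<Rightarrow> (node \<Rightarrow> nat \<Rightarrow> real) \<Rightarrow> nat \<Rightarrow> config spmf" where
  "grow b s s0 s1 W 0 = return_spmf []"
| "grow b s s0 s1 W (Suc n) = bind_spmf (grow b s s0 s1 W n) (add_ball b s s0 s1 W)"

text \<open>
  The split vector is a random vector \<open>V\<close> on a probability space \<open>P\<close>. Independent copies of it,
  one for each node, are obtained on the product space with one factor \<open>P\<close> per node. The law of
  the split tree is the mixture of its conditional laws given these copies.
\<close>

definition split_tree_law ::
  "'a measure \<Rightarrow> (nat \<Rightarrow> 'a \<Rightarrow> real) \<Rightarrow> nat \<Rightarrow> nat \<Rightarrow> nat \<Rightarrow> nat \<Rightarrow> nat \<Rightarrow> config measure" where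
  "split_tree_law P V b s s0 s1 n =
     bind (Pi\<^sub>M (lists {..<b}) (\<lambda>_. P))
       (\<lambda>\<omega>. measure_spmf (grow b s s0 s1 (\<lambda>u i. V i (\<omega> u)) n))"

locale split_tree = prob_space P for P :: "'a measure" +
  fixes V :: "nat \<Rightarrow> 'a \<Rightarrow> real" and b s s0 s1 :: nat
  assumes b_ge_2: "2 \<le> b"
    and s_pos: "0 < s"
    and s0_ge_1: "1 \<le> s0"
    and s0_le: "s0 \<le> s"
    and s1_le: "b * s1 \<le> s + 1 - s0"
    and V_measurable: "\<And>i. i < b \<Longrightarrow> V i \<in> borel_measurable P"
    and V_nonneg: "\<And>i x. i < b \<Longrightarrow> x \<in> space P \<Longrightarrow> 0 \<le> V i x"
    and V_sum: "\<And>x. x \<in> space P \<Longrightarrow> (\<Sum>i<b. V i x) = 1"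
    and V_ident: "\<And>i j. i < b \<Longrightarrow> j < b \<Longrightarrow> distr P borel (V i) = distr P borel (V j)"
    and V_nontrivial: "\<P>(x in P. \<exists>i<b. V i x = 1) < 1"


section \<open>Acyclic digraphs and their embeddings\<close>

text \<open>
  \<open>digraph\<close> excludes loops and parallel arcs; a pair of opposite arcs is a directed cycle.
\<close>

definition acyclic_digraph :: "('v, 'e) pre_digraph \<Rightarrow> bool" where
  "acyclic_digraph H \<longleftrightarrow> digraph H \<and> (\<nexists>p. pre_digraph.cycle H p)"

definition sinks :: "('v, 'e) pre_digraph \<Rightarrow> 'v set" where
  "sinks H = {v \<in> verts H. out_degree H v = 0}"

definition ancestor_verts :: "('v, 'e) pre_digraph \<Rightarrow> 'v set" where
  "ancestor_verts H = {v \<in> verts H - sinks H. card {u \<in> sinks H. v \<rightarrow>\<^sup>+\<^bsub>H\<^esub> u} = 1}"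

text \<open>
  Extensionality of \<open>\<iota>\<close> makes the maps on \<open>verts H\<close> correspond one to one to HOL functions.
\<close>

definition embedding_count :: "('v, 'e) pre_digraph \<Rightarrow> config \<Rightarrow> nat" where
  "embedding_count H xs =
     card {\<iota> \<in> verts H \<rightarrow>\<^sub>E {..<length xs}.
             inj_on \<iota> (verts H) \<and>
             (\<forall>u v. u \<rightarrow>\<^sup>+\<^bsub>H\<^esub> v \<longrightarrow> strict_prefix (xs ! \<iota> u) (xs ! \<iota> v))}"

end

theory Submission
  imports Defs
begin

text \<open>
  Upper bound: fix the balls of the sinks. A vertex with one sink below it has at most \<open>s\<close> times the depth
  of that sink's ball many places, a vertex with two sinks below it at most \<open>s\<close> times the number \<open>c\<close> of
  common ancestors of two balls. So everything reduces to showing that \<open>z\<^sup>c\<close>, summed over all pairs of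
  balls, has expectation \<open>O(n\<^sup>2)\<close> for some \<open>z > 1\<close>. Given the split vectors, let \<open>p\<^sub>u\<close> be the product of the
  weights along the path to \<open>u\<close>; the second moment of the subtree size of an internal node
  \<open>u = v @ [i]\<close> is \<open>O(n\<^sup>2 p\<^sub>v p\<^sub>u)\<close>, and summing \<open>p\<^sub>v p\<^sub>u\<close> over a level gives the sum of \<open>p\<^sub>v\<^sup>2\<close>, whose mean
  is a power of \<open>\<Sum>i. E V\<^sub>i\<^sup>2 < 1\<close>.

  The lower bound holds surely: every node contains at most \<open>s\<close> balls, so at least half of the balls lie
  at depth at least \<open>\<delta> ln n\<close>, and a positive fraction of these lie below one node \<open>w\<close> of fixed depth.
\<close>

section \<open>Splitting a node\<close>

text \<open>The plain second moment bound \<open>n p_u + (n p_u)^2\<close> for the subtree size at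
  \<open>u\<close> is too weak: summed over a level, its first term gives \<open>n\<close> without
  decay, while the series over all levels has to converge even with the weight \<open>z^k\<close>.
  Counting sizes only for internal \<open>u\<close> brings in the parent \<open>v\<close> and
  replaces this by a bound of order \<open>n^2 p_v p_u\<close>.

  An exponential moment is used because the factors of different vertices of \<open>H\<close> are
  dependent: decoupling them costs a power of \<open>c\<close> as high as the number of non-sinks,
  and \<open>z^c\<close> dominates every power. The same double sum also serves vertices with one
  sink below them. Its diagonal is the sum of \<open>z^depth\<close> over single balls, so
  \<open>z^depth\<close> has mean \<open>O(n)\<close> over the balls, and depths much larger than
  \<open>ln n\<close> contribute little.

  How a split shares out its balls never enters. A split does not raise the subtree size of a node
  that was already internal and makes just one node internal, so probabilities are needed only for
  the route of the new ball.\<close>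

definition split_vector :: "nat \<Rightarrow> (nat \<Rightarrow> real) \<Rightarrow> bool" where
  "split_vector b w \<longleftrightarrow> (\<forall>i<b. 0 \<le> w i) \<and> (\<Sum>i<b. w i) = 1"

lemma child_pmf_wf:
  assumes "split_vector b w"
  shows "\<And>i. 0 \<le> (if i < b then w i else 0)"
    and "(\<integral>\<^sup>+i. ennreal (if i < b then w i else 0) \<partial>count_space UNIV) = 1"
proof -
  show "\<And>i. 0 \<le> (if i < b then w i else 0)"
    using assms by (simp add: split_vector_def)
  have "(\<integral>\<^sup>+i. ennreal (if i < b then w i else 0) \<partial>count_space UNIV)
      = (\<integral>\<^sup>+i. ennreal (w i) * indicator {..<b} i \<partial>count_space UNIV)"
    by (intro nn_integral_cong) (auto simp: indicator_def)
  also have "\<dots> = (\<integral>\<^sup>+i. ennreal (w i) \<partial>count_space {..<b})"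
    by (simp add: nn_integral_count_space_indicator)
  also have "\<dots> = (\<Sum>i<b. ennreal (w i))"
    by (simp add: nn_integral_count_space_finite)
  also have "\<dots> = ennreal (\<Sum>i<b. w i)"
    using assms by (intro sum_ennreal) (auto simp: split_vector_def)
  finally show "(\<integral>\<^sup>+i. ennreal (if i < b then w i else 0) \<partial>count_space UNIV) = 1"
    using assms by (simp add: split_vector_def)
qed

lemma pmf_child_pmf:
  assumes "split_vector b w"
  shows "pmf (child_pmf b w) i = (if i < b then w i else 0)"
  unfolding child_pmf_def by (rule pmf_embed_pmf[OF child_pmf_wf[OF assms]])

lemma set_child_pmf:
  assumes "split_vector b w"
  shows "set_pmf (child_pmf b w) \<subseteq> {..<b}"
  using assms by (auto simp: set_pmf_eq pmf_child_pmf split: if_splits)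

lemma finite_balls_at [simp]: "finite (balls_at xs u)"
  by (simp add: balls_at_def)

lemma finite_allotments: "finite R \<Longrightarrow> finite (allotments b s1 R)"
  unfolding allotments_def
  by (rule finite_subset[of _ "R \<rightarrow>\<^sub>E insert None (Some ` {..<b})"]) (auto intro!: finite_PiE)

text \<open>Needed because \<open>pmf_of_set\<close> is meaningful only for nonempty finite sets.
  Witness: number the balls of \<open>R\<close> and give child \<open>i\<close> the
  \<open>i\<close>-th block of \<open>s1\<close> consecutive numbers.\<close>

lemma allotments_nonempty:
  assumes "finite R" "b * s1 \<le> card R"
  shows "allotments b s1 R \<noteq> {}"
proof -
  obtain e where e: "bij_betw e R {..<card R}"
    using ex_bij_betw_finite_nat[OF assms(1)] by (auto simp: atLeast0LessThan)
  define g where "g = (\<lambda>j\<in>R. if e j < b * s1 then Some (e j div s1) else None)"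
  have "g \<in> R \<rightarrow>\<^sub>E insert None (Some ` {..<b})"
    by (auto simp: g_def less_mult_imp_div_less)
  moreover have "card {j \<in> R. g j = Some i} = s1" if "i < b" for i
  proof -
    have "{j \<in> R. g j = Some i} = {j \<in> R. e j \<in> {i * s1..<i * s1 + s1}}"
    proof (intro Collect_cong conj_cong refl)
      fix j assume j: "j \<in> R"
      have "i * s1 + s1 \<le> b * s1"
        using that by (metis Suc_leI add.commute mult_Suc mult_le_mono1)
      then have "e j < b * s1 \<and> e j div s1 = i \<longleftrightarrow> e j \<in> {i * s1..<i * s1 + s1}"
        by (cases "s1 = 0") (auto simp: div_nat_eqI mult.commute
            dividend_less_times_div, (metis add.commute mult.commute times_div_less_eq_dividend
            dividend_less_times_div)+)
      with j show "g j = Some i \<longleftrightarrow> e j \<in> {i * s1..<i * s1 + s1}"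
        by (auto simp: g_def)
    qed
    also have "bij_betw e \<dots> {i * s1..<i * s1 + s1}"
    proof -
      have "i * s1 + s1 \<le> card R"
        using that assms(2) by (metis Suc_leI add.commute mult_Suc mult_le_mono1 order_trans)
      then have "{i * s1..<i * s1 + s1} \<subseteq> e ` R"
        using e by (auto simp: bij_betw_def)
      then have "e ` {j \<in> R. e j \<in> {i * s1..<i * s1 + s1}} = {i * s1..<i * s1 + s1}"
        by blast
      then show ?thesis
        using e by (auto simp: bij_betw_def intro: inj_on_subset)
    qed
    finally show ?thesis
      using bij_betw_same_card by fastforce
  qed
  ultimately show ?thesis
    by (auto simp: allotments_def)
qed

text \<open>Only these facts about the support of a split are kept. That exactly \<open>s0\<close>
  balls stay at \<open>u\<close> has two consequences that matter: \<open>u\<close> remains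
  nonempty, and its children cannot overflow.\<close>

definition redistributes :: "nat \<Rightarrow> nat \<Rightarrow> node \<Rightarrow> config \<Rightarrow> config \<Rightarrow> bool" where
  "redistributes b s0 u xs ys \<longleftrightarrow> length ys = length xs \<and> ball_count ys u = s0 \<and>
     (\<forall>j<length xs. ys ! j = xs ! j \<or> xs ! j = u \<and> (\<exists>i<b. ys ! j = u @ [i]))"

lemma split_node_redistributes:
  assumes w: "split_vector b w" and s0: "s0 \<le> ball_count xs u"
    and s1: "b * s1 \<le> ball_count xs u - s0"
    and ys: "ys \<in> set_pmf (split_node b s0 s1 w u xs)"
  shows "redistributes b s0 u xs ys"
proof -
  let ?\<K> = "{K. K \<subseteq> balls_at xs u \<and> card K = s0}"
  have K: "finite ?\<K>" "?\<K> \<noteq> {}"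
    using obtain_subset_with_card_n[of s0 "balls_at xs u"] s0 by (auto simp: ball_count_def)
  obtain K where K': "K \<subseteq> balls_at xs u" "card K = s0"
    and "ys \<in> set_pmf (let R = balls_at xs u - K in do {
       g \<leftarrow> pmf_of_set (allotments b s1 R);
       h \<leftarrow> Pi_pmf {j \<in> R. g j = None} 0 (\<lambda>_. child_pmf b w);
       return_pmf
         (map (\<lambda>j. if j \<in> R then (case g j of Some i \<Rightarrow> u @ [i] | None \<Rightarrow> u @ [h j]) else xs ! j)
           [0..<length xs])})"
    using ys unfolding split_node_def set_bind_pmf set_pmf_of_set[OF K(2,1)] by auto
  moreover define R where "R = balls_at xs u - K"
  ultimately have *: "ys \<in> set_pmf (do {
       g \<leftarrow> pmf_of_set (allotments b s1 R);
       h \<leftarrow> Pi_pmf {j \<in> R. g j = None} 0 (\<lambda>_. child_pmf b w);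
       return_pmf
         (map (\<lambda>j. if j \<in> R then (case g j of Some i \<Rightarrow> u @ [i] | None \<Rightarrow> u @ [h j]) else xs ! j)
           [0..<length xs])})"
    by (simp add: Let_def)
  have "card R = ball_count xs u - s0"
    using K' by (simp add: R_def ball_count_def card_Diff_subset finite_subset[OF K'(1)])
  then have R: "finite R" "allotments b s1 R \<noteq> {}"
    using s1 allotments_nonempty[of R b s1] by (auto simp: R_def)
  obtain g h where g: "g \<in> allotments b s1 R"
    and h: "h \<in> set_pmf (Pi_pmf {j \<in> R. g j = None} 0 (\<lambda>_. child_pmf b w))"
    and ys: "ys = map (\<lambda>j. if j \<in> R then (case g j of Some i \<Rightarrow> u @ [i] | None \<Rightarrow> u @ [h j])
        else xs ! j) [0..<length xs]"
    using * unfolding set_bind_pmf set_pmf_of_set[OF R(2) finite_allotments[OF R(1)]] by auto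
  have h': "h j < b" if "j \<in> R" "g j = None" for j
    using h that R(1) set_child_pmf[OF w] by (auto simp: set_Pi_pmf PiE_dflt_def)
  have g': "i < b" if "j \<in> R" "g j = Some i" for i j
    using g that by (auto simp: allotments_def PiE_def Pi_def)
  have "balls_at ys u = K"
    using K' by (auto simp: balls_at_def ys R_def split: if_splits option.splits)
  then have "ball_count ys u = s0"
    using K' by (simp add: ball_count_def)
  then show ?thesis
    unfolding redistributes_def using g' h'
    by (auto simp: ys R_def balls_at_def split: option.splits)
qed

lemma ball_count_append:
  "ball_count (xs @ [r]) u = ball_count xs u + of_bool (u = r)"
proof -
  have "balls_at (xs @ [r]) u = balls_at xs u \<union> (if u = r then {length xs} else {})"
    by (auto simp: balls_at_def nth_append less_Suc_eq split: if_splits)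
  then show ?thesis
    by (auto simp: ball_count_def) (simp add: balls_at_def)
qed

lemma ball_count_pos_iff: "0 < ball_count xs u \<longleftrightarrow> u \<in> set xs"
  by (auto simp: ball_count_def card_gt_0_iff balls_at_def in_set_conv_nth)

lemma internal_iff: "internal xs u \<longleftrightarrow> (\<exists>v\<in>set xs. strict_prefix u v)"
  unfolding internal_def ball_count_pos_iff by blast

section \<open>Valid configurations\<close>

text \<open>The invariant on which the lower bound rests. Its last clause, weaker than the exact
  count \<open>s0\<close>, is what lets a vertex of \<open>H\<close> be put at any proper prefix of
  a ball's node.\<close>

definition valid_config :: "nat \<Rightarrow> nat \<Rightarrow> config \<Rightarrow> bool" where
  "valid_config b s xs \<longleftrightarrow> set xs \<subseteq> lists {..<b} \<and> (\<forall>u. ball_count xs u \<le> s) \<and>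
     (\<forall>u. internal xs u \<longrightarrow> 0 < ball_count xs u)"

definition subtree_count :: "config \<Rightarrow> node \<Rightarrow> nat" where
  "subtree_count xs u = card {j. j < length xs \<and> prefix u (xs ! j)}"

definition insertion_point :: "nat \<Rightarrow> config \<Rightarrow> node \<Rightarrow> bool" where
  "insertion_point b xs r \<longleftrightarrow> r \<in> lists {..<b} \<and> \<not> internal xs r \<and>
     (\<forall>v. strict_prefix v r \<longrightarrow> internal xs v)"

text \<open>One form for insertions with and without a split; the moment estimates use the counts
  only through upper bounds. A node that turns internal is the insertion point itself, and its
  subtree then holds just the balls being split, so every size starts from a constant.\<close>

definition insertion_result :: "nat \<Rightarrow> nat \<Rightarrow> config \<Rightarrow> node \<Rightarrow> config \<Rightarrow> bool" where
  "insertion_result b s xs r ys \<longleftrightarrow> length ys = Suc (length xs) \<and> valid_config b s ys \<and>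
     (\<forall>u. internal xs u \<longrightarrow> subtree_count ys u \<le> subtree_count xs u + of_bool (prefix u r)) \<and>
     (\<forall>u. internal ys u \<longrightarrow> \<not> internal xs u \<longrightarrow> u = r \<and> subtree_count ys u \<le> Suc s)"

lemma subtree_count_append:
  "subtree_count (xs @ [r]) u = subtree_count xs u + of_bool (prefix u r)"
proof -
  have "{j. j < length (xs @ [r]) \<and> prefix u ((xs @ [r]) ! j)}
      = {j. j < length xs \<and> prefix u (xs ! j)} \<union> (if prefix u r then {length xs} else {})"
    by (auto simp: nth_append less_Suc_eq split: if_splits)
  then show ?thesis
    by (auto simp: subtree_count_def)
qed

lemma subtree_count_not_internal:
  assumes "\<not> internal xs u"
  shows "subtree_count xs u = ball_count xs u"
proof -
  have "{j. j < length xs \<and> prefix u (xs ! j)} = balls_at xs u"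
    using assms by (force simp: balls_at_def internal_iff strict_prefix_def)
  then show ?thesis
    by (simp add: subtree_count_def ball_count_def)
qed

lemma insertion_result_append:
  assumes v: "valid_config b s xs" and r: "insertion_point b xs r" and c: "ball_count xs r < s"
  shows "insertion_result b s xs r (xs @ [r])"
proof -
  have int: "internal (xs @ [r]) u \<longleftrightarrow> internal xs u" for u
    using r by (auto simp: internal_iff insertion_point_def)
  have "valid_config b s (xs @ [r])"
    using v r c unfolding valid_config_def int
    by (auto simp: ball_count_append insertion_point_def)
  then show ?thesis
    unfolding insertion_result_def int by (simp add: subtree_count_append)
qed

text \<open>One split is enough: of the \<open>s + 1\<close> balls at \<open>r\<close>,
  \<open>s0 > 0\<close> stay, and the children of \<open>r\<close> were empty because
  \<open>r\<close> was not internal. So no child ends up with more than \<open>s\<close>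
  balls.\<close>

lemma insertion_result_redistributes:
  assumes v: "valid_config b s xs" and r: "insertion_point b xs r" and c: "ball_count xs r = s"
    and s0: "0 < s0" and ys: "redistributes b s0 r (xs @ [r]) ys" and le: "s0 \<le> s"
  shows "insertion_result b s xs r ys"
proof -
  let ?zs = "xs @ [r]"
  have len: "length ys = length ?zs" and cr: "ball_count ys r = s0"
    using ys by (auto simp: redistributes_def)
  have step: "ys ! j = ?zs ! j \<or> ?zs ! j = r \<and> (\<exists>i<b. ys ! j = r @ [i])" if "j < length ys" for j
    using ys that by (auto simp: redistributes_def)
  have ni: "\<not> internal xs r" and anc: "strict_prefix u r \<Longrightarrow> internal xs u" for u
    using r by (auto simp: insertion_point_def)
  have zs_set: "\<not> strict_prefix r v" if "v \<in> set ?zs" for v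
    using that ni by (auto simp: internal_iff)
  have int: "internal ys u \<Longrightarrow> \<not> internal xs u \<Longrightarrow> u = r" for u
  proof -
    assume "internal ys u" "\<not> internal xs u"
    then obtain j where j: "j < length ys" "strict_prefix u (ys ! j)"
      by (auto simp: internal_iff in_set_conv_nth)
    show "u = r"
    proof (rule ccontr)
      assume "u \<noteq> r"
      from step[OF j(1)] show False
      proof (elim disjE conjE exE)
        assume *: "ys ! j = ?zs ! j"
        then have "ys ! j \<in> insert r (set xs)"
          using j(1) len nth_mem[of j ?zs] by auto
        then show False
          using j(2) anc \<open>\<not> internal xs u\<close> unfolding internal_iff by blast
      next
        fix i assume "ys ! j = r @ [i]"
        then have "strict_prefix u r"
          using j(2) \<open>u \<noteq> r\<close> by (auto simp: strict_prefix_def)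
        then show False
          using anc \<open>\<not> internal xs u\<close> by blast
      qed
    qed
  qed
  have same: "ball_count ys u = ball_count xs u" if "u \<noteq> r" "\<And>i. u \<noteq> r @ [i]" for u
  proof -
    have "balls_at ys u = balls_at ?zs u"
      unfolding balls_at_def using step len that by (intro Collect_cong conj_cong) fastforce+
    then have "ball_count ys u = ball_count ?zs u"
      by (simp add: ball_count_def)
    then show ?thesis
      using that by (simp add: ball_count_append)
  qed
  have child: "ball_count ys (r @ [i]) \<le> s" for i
  proof -
    have "balls_at ys (r @ [i]) \<subseteq> balls_at ?zs r - balls_at ys r"
    proof
      fix j assume "j \<in> balls_at ys (r @ [i])"
      then have j: "j < length ys" "ys ! j = r @ [i]"
        by (auto simp: balls_at_def)
      moreover have "?zs ! j \<noteq> r @ [i]"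
        using zs_set[of "?zs ! j"] nth_mem[of j ?zs] j(1) len by (auto simp: strict_prefix_def)
      ultimately show "j \<in> balls_at ?zs r - balls_at ys r"
        using step[OF j(1)] len by (auto simp: balls_at_def)
    qed
    then have "ball_count ys (r @ [i]) \<le> card (balls_at ?zs r - balls_at ys r)"
      unfolding ball_count_def by (intro card_mono) auto
    also have "\<dots> = ball_count ?zs r - ball_count ys r"
      unfolding ball_count_def
    proof (intro card_Diff_subset)
      show "balls_at ys r \<subseteq> balls_at ?zs r"
        unfolding balls_at_def using step len by fastforce
    qed simp
    finally show ?thesis
      using s0 cr c by (simp add: ball_count_append)
  qed
  have "valid_config b s ys"
    unfolding valid_config_def
  proof (intro conjI allI impI)
    show "set ys \<subseteq> lists {..<b}"
    proof
      fix v assume "v \<in> set ys"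
      then obtain j where j: "j < length ys" "v = ys ! j"
        by (auto simp: in_set_conv_nth)
      have "set ?zs \<subseteq> lists {..<b}"
        using v r by (auto simp: valid_config_def insertion_point_def)
      then have "?zs ! j \<in> lists {..<b}" "r \<in> lists {..<b}"
        using nth_mem[of j ?zs] j(1) len by auto
      then show "v \<in> lists {..<b}"
        using step[OF j(1)] j(2) by auto
    qed
    show "ball_count ys u \<le> s" for u
    proof (cases "u = r \<or> (\<exists>i. u = r @ [i])")
      case True
      then show ?thesis using child cr le by auto
    next
      case False
      then show ?thesis using same[of u] v by (auto simp: valid_config_def)
    qed
    show "0 < ball_count ys u" if "internal ys u" for u
    proof (cases "u = r")
      case True
      then show ?thesis using cr s0 by simp
    next
      case False
      then have i: "internal xs u"
        using int that by blast
      then have "\<not> strict_prefix r u"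
        using ni by (auto simp: internal_iff dest: prefix_order.less_trans)
      then have "ball_count ys u = ball_count xs u"
        using False by (intro same) (auto simp: strict_prefix_def)
      then show ?thesis
        using v i by (simp add: valid_config_def)
    qed
  qed
  \<comment> \<open>Balls move only from \<open>r\<close> to its children, so a count can rise only
    at some \<open>r @ [i]\<close>. Such a node is different from \<open>r\<close> and not internal
    in \<open>xs\<close>, since otherwise \<open>r\<close> would be internal too.\<close>
  moreover have "subtree_count ys u \<le> subtree_count ?zs u" if "internal xs u \<or> u = r" for u
    unfolding subtree_count_def
  proof (rule card_mono)
    show "{j. j < length ys \<and> prefix u (ys ! j)} \<subseteq> {j. j < length ?zs \<and> prefix u (?zs ! j)}"
    proof safe
      fix j assume j: "j < length ys" "prefix u (ys ! j)"
      then show "j < length ?zs" using len by simp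
      show "prefix u (?zs ! j)"
        using step[OF j(1)]
      proof (elim disjE conjE exE)
        fix i assume i: "?zs ! j = r" "ys ! j = r @ [i]"
        have "\<not> strict_prefix r u" if "internal xs u"
          using that ni by (meson internal_iff prefix_order.less_trans)
        then have "u \<noteq> r @ [i]"
          using \<open>internal xs u \<or> u = r\<close> by (auto simp: strict_prefix_def)
        then show ?thesis
          using i j(2) by auto
      qed (use j(2) in simp)
    qed
  qed simp
  moreover have "subtree_count ?zs r = Suc s"
    using ni c by (simp add: subtree_count_append subtree_count_not_internal)
  ultimately show ?thesis
    unfolding insertion_result_def using len int
    by (metis (mono_tags) length_append_singleton order_refl subtree_count_append)
qed

section \<open>Inserting a ball\<close>

text \<open>The start \<open>v\<close> is a parameter so that the recursion of \<open>route\<close>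
  can be followed. With start \<open>[]\<close> this is the product of weights from the
  overview.\<close>

definition path_weight :: "(node \<Rightarrow> nat \<Rightarrow> real) \<Rightarrow> node \<Rightarrow> node \<Rightarrow> real" where
  "path_weight W v w = (\<Prod>k<length w. W (v @ take k w) (w ! k))"

lemma path_weight_Nil [simp]: "path_weight W v [] = 1"
  by (simp add: path_weight_def)

lemma path_weight_Cons: "path_weight W v (i # w) = W v i * path_weight W (v @ [i]) w"
  by (simp add: path_weight_def prod.lessThan_Suc_shift del: prod.lessThan_Suc)

lemma path_weight_snoc: "path_weight W v (w @ [i]) = path_weight W v w * W (v @ w) i"
  by (simp add: path_weight_def nth_append)

lemma nn_integral_measure_spmf_bind_pmf:
  "(\<integral>\<^sup>+y. f y \<partial>measure_spmf (bind_pmf p g)) = (\<integral>\<^sup>+x. \<integral>\<^sup>+y. f y \<partial>measure_spmf (g x) \<partial>measure_pmf p)"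
  unfolding measure_spmf_bind_pmf
  by (subst nn_integral_bind[where B = "count_space UNIV"]) auto

lemma nn_integral_measure_spmf_bind:
  "(\<integral>\<^sup>+y. f y \<partial>measure_spmf (bind_spmf p g)) = (\<integral>\<^sup>+x. \<integral>\<^sup>+y. f y \<partial>measure_spmf (g x) \<partial>measure_spmf p)"
  unfolding measure_spmf_bind
  by (subst nn_integral_bind[where B = "count_space UNIV"]) auto

locale split_process =
  fixes b s s0 s1 :: nat and W :: "node \<Rightarrow> nat \<Rightarrow> real"
  assumes s0_pos: "0 < s0" and s0_le_s: "s0 \<le> s" and s1_bound: "b * s1 \<le> s + 1 - s0"
    and W_split: "\<And>u. u \<in> lists {..<b} \<Longrightarrow> split_vector b (W u)"
begin

lemma path_weight_nonneg:
  "v \<in> lists {..<b} \<Longrightarrow> w \<in> lists {..<b} \<Longrightarrow> 0 \<le> path_weight W v w"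
proof (induction w arbitrary: v)
  case (Cons i w)
  then have "0 \<le> path_weight W (v @ [i]) w"
    by (intro Cons.IH) auto
  then show ?case
    using W_split[OF Cons.prems(1)] Cons.prems(2) by (auto simp: path_weight_Cons split_vector_def)
qed simp

text \<open>The walk moves on only from internal nodes, which are shorter than the longest node of a
  ball. Hence \<open>m - length u\<close> decreases, and no mass is lost.\<close>

lemma route_insertion_point:
  assumes xs: "set xs \<subseteq> lists {..<b}" and u: "u \<in> lists {..<b}"
  shows "lossless_spmf (route b W xs u) \<and> (\<forall>r\<in>set_spmf (route b W xs u).
    prefix u r \<and> r \<in> lists {..<b} \<and> \<not> internal xs r \<and>
    (\<forall>v. prefix u v \<longrightarrow> strict_prefix v r \<longrightarrow> internal xs v))"
proof -
  obtain m where m: "\<forall>v\<in>set xs. length v \<le> m"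
    using finite_nat_set_iff_bounded_le[of "length ` set xs"] by auto
  show ?thesis
    using u
  proof (induction "m - length u" arbitrary: u rule: less_induct)
    case (less u)
    show ?case
    proof (cases "internal xs u")
      case False
      then have "route b W xs u = return_spmf u"
        by (subst route.simps) simp
      then show ?thesis
        using less.prems False by (auto simp: strict_prefix_def)
    next
      case True
      then obtain v where "v \<in> set xs" "strict_prefix u v"
        by (auto simp: internal_iff)
      then have "length u < m"
        using m by (meson prefix_length_less order.strict_trans2)
      have IH: "lossless_spmf (route b W xs (u @ [i])) \<and> (\<forall>r\<in>set_spmf (route b W xs (u @ [i])).
          prefix (u @ [i]) r \<and> r \<in> lists {..<b} \<and> \<not> internal xs r \<and>
          (\<forall>v. prefix (u @ [i]) v \<longrightarrow> strict_prefix v r \<longrightarrow> internal xs v))"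
        if "i \<in> set_pmf (child_pmf b (W u))" for i
        using that set_child_pmf[OF W_split[OF less.prems]] less.prems \<open>length u < m\<close>
        by (intro less.hyps) auto
      have ext: "internal xs v"
        if "prefix (u @ [i]) r" "\<forall>v. prefix (u @ [i]) v \<longrightarrow> strict_prefix v r \<longrightarrow> internal xs v"
          "prefix u v" "strict_prefix v r" for i v r
      proof (cases "v = u")
        case False
        have "prefix (u @ [i]) v \<or> strict_prefix v (u @ [i])"
          using prefix_same_cases[of v r "u @ [i]"] that(1,4) by (auto simp: strict_prefix_def)
        then show ?thesis
        proof
          assume "strict_prefix v (u @ [i])"
          then have "prefix v u"
            by (auto simp: strict_prefix_def)
          then show ?thesis
            using False that(3) prefix_order.antisym by blast
        qed (use that in blast)
      qed (use True in simp)
      have "route b W xs u = bind_pmf (child_pmf b (W u)) (\<lambda>i. route b W xs (u @ [i]))"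
        using True by (subst route.simps) simp
      then have "lossless_spmf (route b W xs u) \<longleftrightarrow>
            (\<forall>i\<in>set_pmf (child_pmf b (W u)). lossless_spmf (route b W xs (u @ [i])))"
        and "r \<in> set_spmf (route b W xs u) \<longleftrightarrow>
            (\<exists>i\<in>set_pmf (child_pmf b (W u)). r \<in> set_spmf (route b W xs (u @ [i])))" for r
        by (simp_all add: set_spmf_bind_pmf bind_UNION)
      moreover have "prefix u r \<and> r \<in> lists {..<b} \<and> \<not> internal xs r \<and>
          (\<forall>v. prefix u v \<longrightarrow> strict_prefix v r \<longrightarrow> internal xs v)"
        if i: "i \<in> set_pmf (child_pmf b (W u))" and r: "r \<in> set_spmf (route b W xs (u @ [i]))" for i r
      proof -
        have r': "prefix (u @ [i]) r" "r \<in> lists {..<b}" "\<not> internal xs r"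
          "\<forall>v. prefix (u @ [i]) v \<longrightarrow> strict_prefix v r \<longrightarrow> internal xs v"
          using IH[OF i] r by auto
        show ?thesis
          using r'(2,3) append_prefixD[OF r'(1)] ext[OF r'(1,4)] by blast
      qed
      ultimately show ?thesis
        using IH by blast
    qed
  qed
qed

text \<open>Only an inequality, since the walk may stop at a non-internal node short of
  \<open>v @ w\<close>. The bound is uniform in \<open>xs\<close>, so it can be used at every
  insertion.\<close>

lemma route_prefix_le:
  assumes xs: "set xs \<subseteq> lists {..<b}" and v: "v \<in> lists {..<b}" and w: "w \<in> lists {..<b}"
  shows "emeasure (measure_spmf (route b W xs v)) {r. prefix (v @ w) r} \<le> ennreal (path_weight W v w)"
  using v w
proof (induction w arbitrary: v)
  case Nil
  then show ?case
    using measure_spmf.subprob_emeasure_le_1 by auto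
next
  case (Cons i w)
  let ?A = "{r. prefix (v @ i # w) r}"
  have i: "i < b" "v @ [i] \<in> lists {..<b}"
    using Cons.prems by auto
  have W: "split_vector b (W v)"
    using W_split Cons.prems by blast
  show ?case
  proof (cases "internal xs v")
    case False
    then have "route b W xs v = return_spmf v"
      by (subst route.simps) simp
    then show ?thesis
      by (simp add: measure_spmf_return_spmf emeasure_return)
  next
    case True
    have zero: "emeasure (measure_spmf (route b W xs (v @ [k]))) ?A = 0" if "k < b" "k \<noteq> i" for k
    proof -
      have "r \<notin> ?A" if "r \<in> set_spmf (route b W xs (v @ [k]))" for r
      proof
        assume "r \<in> ?A"
        moreover have "prefix (v @ [k]) r"
          using route_insertion_point[OF xs, of "v @ [k]"] that \<open>k < b\<close> Cons.prems by auto
        ultimately show False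
          using \<open>k \<noteq> i\<close> by (auto simp: prefix_def)
      qed
      then show ?thesis
        by (subst measure_spmf.emeasure_eq_measure) (auto simp: measure_spmf_zero_iff)
    qed
    have "emeasure (measure_spmf (route b W xs v)) ?A
        = (\<integral>\<^sup>+r. indicator ?A r \<partial>measure_spmf
            (bind_pmf (child_pmf b (W v)) (\<lambda>i. route b W xs (v @ [i]))))"
      using True by (subst route.simps) simp
    also have "\<dots> = (\<integral>\<^sup>+k. emeasure (measure_spmf (route b W xs (v @ [k]))) ?A \<partial>child_pmf b (W v))"
      by (simp add: nn_integral_measure_spmf_bind_pmf)
    also have "\<dots> \<le> (\<integral>\<^sup>+k. ennreal (path_weight W (v @ [i]) w) * indicator {i} k \<partial>child_pmf b (W v))"
    proof (intro nn_integral_mono_AE AE_pmfI)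
      fix k assume "k \<in> set_pmf (child_pmf b (W v))"
      then have "k < b"
        using set_child_pmf[OF W] by auto
      then show "emeasure (measure_spmf (route b W xs (v @ [k]))) ?A
          \<le> ennreal (path_weight W (v @ [i]) w) * indicator {i} k"
        using zero Cons.IH[OF i(2)] Cons.prems by (cases "k = i") auto
    qed
    also have "\<dots> = ennreal (path_weight W (v @ [i]) w) * ennreal (W v i)"
      using i(1) by (simp add: nn_integral_cmult_indicator emeasure_pmf_single pmf_child_pmf[OF W])
    also have "\<dots> = ennreal (path_weight W v (i # w))"
      using W i path_weight_nonneg[of "v @ [i]" w] Cons.prems
      by (simp add: path_weight_Cons ennreal_mult' split_vector_def mult.commute)
    finally show ?thesis .
  qed
qed

lemma split_node_insertion_result:
  assumes v: "valid_config b s xs" and r: "insertion_point b xs r" and c: "ball_count xs r = s"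
    and ys: "ys \<in> set_pmf (split_node b s0 s1 (W r) r (xs @ [r]))"
  shows "insertion_result b s xs r ys"
proof (rule insertion_result_redistributes[OF v r c s0_pos _ s0_le_s])
  show "redistributes b s0 r (xs @ [r]) ys"
    using ys s0_le_s s1_bound c W_split r
    by (intro split_node_redistributes) (auto simp: ball_count_append insertion_point_def)
qed

text \<open>A closed form of the loop on the arguments that occur: appending a ball can overfill
  only \<open>r\<close>, and after one split nothing is overfull. Measurability is derived from the
  same form.\<close>

lemma settle_append:
  assumes v: "valid_config b s xs" and r: "insertion_point b xs r"
  shows "settle b s s0 s1 W (xs @ [r]) = (if ball_count xs r < s then return_spmf (xs @ [r])
    else bind_pmf (split_node b s0 s1 (W r) r (xs @ [r])) return_spmf)"
proof (cases "ball_count xs r < s")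
  case True
  then have "\<not> (\<exists>u. ball_count (xs @ [r]) u > s)"
    using v by (auto simp: ball_count_append valid_config_def not_less)
  then show ?thesis
    using True by (subst settle.simps) simp
next
  case False
  then have c: "ball_count xs r = s"
    using v by (auto simp: valid_config_def not_less intro: order_antisym)
  have over: "s < ball_count (xs @ [r]) u \<longleftrightarrow> u = r" for u
    using v c by (auto simp: ball_count_append valid_config_def not_less)
  have "settle b s s0 s1 W (xs @ [r])
      = bind_pmf (split_node b s0 s1 (W r) r (xs @ [r])) (settle b s s0 s1 W)"
    by (subst settle.simps) (simp add: over Let_def)
  also have "\<dots> = bind_pmf (split_node b s0 s1 (W r) r (xs @ [r])) return_spmf"
  proof (intro bind_pmf_cong refl)
    fix ys assume "ys \<in> set_pmf (split_node b s0 s1 (W r) r (xs @ [r]))"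
    then have "\<not> (\<exists>u. s < ball_count ys u)"
      using split_node_insertion_result[OF v r c]
      by (simp add: insertion_result_def valid_config_def not_less)
    then show "settle b s s0 s1 W ys = return_spmf ys"
      by (subst settle.simps) simp
  qed
  finally show ?thesis
    using False by simp
qed

lemma settle_insertion_result:
  assumes v: "valid_config b s xs" and r: "insertion_point b xs r"
  shows "lossless_spmf (settle b s s0 s1 W (xs @ [r])) \<and>
    (\<forall>ys\<in>set_spmf (settle b s s0 s1 W (xs @ [r])). insertion_result b s xs r ys)"
proof (cases "ball_count xs r < s")
  case True
  then show ?thesis
    using insertion_result_append[OF v r] by (simp add: settle_append[OF v r])
next
  case False
  then have "ball_count xs r = s"
    using v by (auto simp: valid_config_def not_less intro: order_antisym)
  then show ?thesis
    using False split_node_insertion_result[OF v r]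
    by (auto simp: settle_append[OF v r] set_spmf_bind_pmf)
qed

lemma route_root:
  assumes "valid_config b s xs"
  shows "lossless_spmf (route b W xs [])"
    and "r \<in> set_spmf (route b W xs []) \<Longrightarrow> insertion_point b xs r"
  using route_insertion_point[of xs "[]"] assms
  by (auto simp: valid_config_def insertion_point_def)

lemma grow_valid:
  "lossless_spmf (grow b s s0 s1 W n) \<and>
    (\<forall>xs\<in>set_spmf (grow b s s0 s1 W n). valid_config b s xs \<and> length xs = n)"
proof (induction n)
  case 0
  then show ?case
    by (auto simp: valid_config_def internal_iff ball_count_def balls_at_def)
next
  case (Suc n)
  have add: "lossless_spmf (add_ball b s s0 s1 W xs)"
      "\<And>ys. ys \<in> set_spmf (add_ball b s s0 s1 W xs) \<Longrightarrow> valid_config b s ys \<and> length ys = Suc n"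
    if "xs \<in> set_spmf (grow b s s0 s1 W n)" for xs
  proof -
    have xs: "valid_config b s xs" "length xs = n"
      using Suc.IH that by blast+
    have "lossless_spmf (settle b s s0 s1 W (xs @ [r])) \<and>
      (\<forall>ys\<in>set_spmf (settle b s s0 s1 W (xs @ [r])). insertion_result b s xs r ys)"
      if "r \<in> set_spmf (route b W xs [])" for r
      using settle_insertion_result[OF xs(1) route_root(2)[OF xs(1) that]] .
    note * = this
    show "lossless_spmf (add_ball b s s0 s1 W xs)"
      unfolding add_ball_def lossless_bind_spmf using route_root(1)[OF xs(1)] * by blast
    fix ys assume "ys \<in> set_spmf (add_ball b s s0 s1 W xs)"
    then obtain r where "r \<in> set_spmf (route b W xs [])"
        "ys \<in> set_spmf (settle b s s0 s1 W (xs @ [r]))"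
      unfolding add_ball_def set_bind_spmf bind_UNION by auto
    then have "insertion_result b s xs r ys"
      using * by blast
    then show "valid_config b s ys \<and> length ys = Suc n"
      using xs(2) by (simp add: insertion_result_def)
  qed
  show ?case
  proof (intro conjI ballI)
    show "lossless_spmf (grow b s s0 s1 W (Suc n))"
      unfolding grow.simps lossless_bind_spmf using Suc.IH add(1) by blast
    fix ys assume "ys \<in> set_spmf (grow b s s0 s1 W (Suc n))"
    then obtain xs where "xs \<in> set_spmf (grow b s s0 s1 W n)"
        "ys \<in> set_spmf (add_ball b s s0 s1 W xs)"
      unfolding grow.simps set_bind_spmf bind_UNION by auto
    from add(2)[OF this] show "valid_config b s ys" "length ys = Suc n"
      by blast+
  qed
qed

text \<open>The one-step recursion behind all moment bounds. Given the tree, the new ball is routed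
  below \<open>u\<close> with probability at most \<open>path_weight W [] u\<close>, uniformly in
  the tree, so this factor comes out of the expectation of \<open>h\<close>. The premise on
  \<open>f\<close> holds for every outcome of the split, which is thus integrated out.\<close>

lemma nn_integral_grow_Suc_le:
  assumes k: "\<And>xs r ys. valid_config b s xs \<Longrightarrow> insertion_point b xs r \<Longrightarrow> length xs = n \<Longrightarrow>
      insertion_result b s xs r ys \<Longrightarrow> f ys \<le> g xs + indicator {r. prefix u r} r * h xs"
    and u: "u \<in> lists {..<b}"
  shows "(\<integral>\<^sup>+ys. f ys \<partial>measure_spmf (grow b s s0 s1 W (Suc n)))
    \<le> (\<integral>\<^sup>+xs. g xs \<partial>measure_spmf (grow b s s0 s1 W n)) +
      ennreal (path_weight W [] u) * (\<integral>\<^sup>+xs. h xs \<partial>measure_spmf (grow b s s0 s1 W n))"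
proof -
  let ?U = "{r. prefix u r}"
  have add: "(\<integral>\<^sup>+ys. f ys \<partial>measure_spmf (add_ball b s s0 s1 W xs))
      \<le> g xs + ennreal (path_weight W [] u) * h xs"
    if "xs \<in> set_spmf (grow b s s0 s1 W n)" for xs
  proof -
    have v: "valid_config b s xs" "length xs = n"
      using that grow_valid[of n] by auto
    have "(\<integral>\<^sup>+ys. f ys \<partial>measure_spmf (add_ball b s s0 s1 W xs))
        = (\<integral>\<^sup>+r. \<integral>\<^sup>+ys. f ys \<partial>measure_spmf (settle b s s0 s1 W (xs @ [r]))
            \<partial>measure_spmf (route b W xs []))"
      by (simp add: add_ball_def nn_integral_measure_spmf_bind)
    also have "\<dots> \<le> (\<integral>\<^sup>+r. g xs + indicator ?U r * h xs \<partial>measure_spmf (route b W xs []))"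
    proof (intro nn_integral_mono_AE, unfold AE_measure_spmf_iff, intro ballI)
      fix r assume "r \<in> set_spmf (route b W xs [])"
      then have r: "insertion_point b xs r"
        using route_root[OF v(1)] by blast
      have "(\<integral>\<^sup>+ys. f ys \<partial>measure_spmf (settle b s s0 s1 W (xs @ [r])))
          \<le> (\<integral>\<^sup>+ys. g xs + indicator ?U r * h xs \<partial>measure_spmf (settle b s s0 s1 W (xs @ [r])))"
        using settle_insertion_result[OF v(1) r] k[OF v(1) r v(2)]
        by (intro nn_integral_mono_AE) (simp add: AE_measure_spmf_iff)
      also have "\<dots> \<le> g xs + indicator ?U r * h xs"
        using settle_insertion_result[OF v(1) r]
        by (simp add: lossless_spmf_def weight_spmf_def measure_spmf.emeasure_eq_measure)
      finally show "(\<integral>\<^sup>+ys. f ys \<partial>measure_spmf (settle b s s0 s1 W (xs @ [r])))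
          \<le> g xs + indicator ?U r * h xs" .
    qed
    also have "\<dots> = g xs * emeasure (measure_spmf (route b W xs [])) UNIV
        + emeasure (measure_spmf (route b W xs [])) ?U * h xs"
      by (subst nn_integral_add) (auto simp: nn_integral_multc space_measure_spmf)
    also have "\<dots> \<le> g xs * 1 + ennreal (path_weight W [] u) * h xs"
      using route_prefix_le[of xs "[]" u] v u measure_spmf.subprob_emeasure_le_1
      by (intro add_mono mult_mono) (auto simp: valid_config_def)
    finally show ?thesis by simp
  qed
  have "(\<integral>\<^sup>+ys. f ys \<partial>measure_spmf (grow b s s0 s1 W (Suc n)))
      = (\<integral>\<^sup>+xs. \<integral>\<^sup>+ys. f ys \<partial>measure_spmf (add_ball b s s0 s1 W xs)
          \<partial>measure_spmf (grow b s s0 s1 W n))"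
    by (simp add: nn_integral_measure_spmf_bind)
  also have "\<dots> \<le> (\<integral>\<^sup>+xs. g xs + ennreal (path_weight W [] u) * h xs \<partial>measure_spmf (grow b s s0 s1 W n))"
    using add by (intro nn_integral_mono_AE) (simp add: AE_measure_spmf_iff)
  also have "\<dots> = (\<integral>\<^sup>+xs. g xs \<partial>measure_spmf (grow b s s0 s1 W n)) +
      ennreal (path_weight W [] u) * (\<integral>\<^sup>+xs. h xs \<partial>measure_spmf (grow b s s0 s1 W n))"
    by (subst nn_integral_add) (auto simp: nn_integral_cmult)
  finally show ?thesis .
qed

end

section \<open>Moments of subtree sizes\<close>

context split_process
begin

abbreviation tree_integral :: "nat \<Rightarrow> (config \<Rightarrow> ennreal) \<Rightarrow> ennreal" where
  "tree_integral n f \<equiv> \<integral>\<^sup>+xs. f xs \<partial>measure_spmf (grow b s s0 s1 W n)"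

lemma path_weight_snoc_le:
  assumes "v \<in> lists {..<b}" "i < b"
  shows "path_weight W [] (v @ [i]) \<le> path_weight W [] v"
proof -
  have w: "0 \<le> W v j" if "j < b" for j
    using W_split[OF assms(1)] that by (simp add: split_vector_def)
  have "W v i \<le> (\<Sum>j<b. W v j)"
    by (rule member_le_sum) (use w assms(2) in auto)
  then have "W v i \<le> 1"
    using W_split[OF assms(1)] by (simp add: split_vector_def)
  then show ?thesis
    using path_weight_nonneg[of "[]" v] assms w[of i]
    by (simp add: path_weight_snoc mult_left_le)
qed

lemma internal_new:
  assumes "insertion_point b xs r" "insertion_result b s xs r ys" "internal ys u" "\<not> internal xs u"
  shows "u = r" "subtree_count ys u \<le> Suc s" "\<And>v. strict_prefix v u \<Longrightarrow> internal xs v"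
  using assms by (auto simp: insertion_point_def insertion_result_def)

lemma internal_old:
  assumes "insertion_result b s xs r ys" "internal xs u"
  shows "subtree_count ys u \<le> subtree_count xs u + of_bool (prefix u r)"
  using assms by (auto simp: insertion_result_def)

lemma tree_integral_le_const:
  assumes "\<And>xs. f xs \<le> c"
  shows "tree_integral n f \<le> c"
proof -
  have "tree_integral n f \<le> tree_integral n (\<lambda>_. c)"
    by (intro nn_integral_mono assms)
  also have "\<dots> \<le> c * 1"
    using measure_spmf.subprob_emeasure_le_1 by (simp del: mult_1_right, intro mult_left_mono) auto
  finally show ?thesis by simp
qed

lemma nn_integral_return_spmf [simp]: "(\<integral>\<^sup>+x. f x \<partial>measure_spmf (return_spmf a)) = f a"
  by (simp add: measure_spmf_return_spmf nn_integral_return)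

lemma internal_Nil [simp]: "\<not> internal [] u"
  by (simp add: internal_iff)

text \<open>Union bound over the \<open>n\<close> insertions: a node turns internal only when a ball
  is inserted exactly there.\<close>

lemma tree_integral_internal_le:
  assumes u: "u \<in> lists {..<b}"
  shows "tree_integral n (\<lambda>xs. of_bool (internal xs u)) \<le> ennreal (real n * path_weight W [] u)"
proof (induction n)
  case (Suc n)
  have p: "0 \<le> path_weight W [] u"
    using u by (intro path_weight_nonneg) auto
  have "tree_integral (Suc n) (\<lambda>xs. of_bool (internal xs u)) \<le>
      tree_integral n (\<lambda>xs. of_bool (internal xs u)) +
      ennreal (path_weight W [] u) * tree_integral n (\<lambda>_. 1)"
    by (rule nn_integral_grow_Suc_le[OF _ u]) (auto dest!: internal_new(1))
  also have "\<dots> \<le> ennreal (real n * path_weight W [] u) + ennreal (path_weight W [] u) * 1"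
    by (intro add_mono mult_left_mono Suc.IH tree_integral_le_const) auto
  also have "\<dots> = ennreal (real (Suc n) * path_weight W [] u)"
    using p by (simp add: algebra_simps flip: ennreal_plus)
  finally show ?case .
qed simp

lemma tree_integral_internal_count_le:
  assumes u: "u \<in> lists {..<b}"
  shows "tree_integral n (\<lambda>xs. of_bool (internal xs u) * of_nat (subtree_count xs u))
    \<le> ennreal (real n * path_weight W [] u * (s + 2))"
proof (induction n)
  case (Suc n)
  have p: "0 \<le> path_weight W [] u"
    using u by (intro path_weight_nonneg) auto
  let ?f = "\<lambda>xs. of_bool (internal xs u) * of_nat (subtree_count xs u) :: ennreal"
  \<comment> \<open>An insertion below \<open>u\<close> adds 1 if \<open>u\<close> is already
    internal and at most \<open>s + 1\<close> if \<open>u\<close> turns internal;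
    \<open>s + 2\<close> covers both.\<close>
  have "tree_integral (Suc n) ?f \<le> tree_integral n ?f +
      ennreal (path_weight W [] u) * tree_integral n (\<lambda>_. of_nat (s + 2))"
  proof (rule nn_integral_grow_Suc_le[OF _ u])
    fix xs r ys assume *: "insertion_point b xs r" "insertion_result b s xs r ys"
    have "of_bool (internal ys u) * subtree_count ys u
        \<le> of_bool (internal xs u) * subtree_count xs u + of_bool (prefix u r) * (s + 2)"
      using internal_new(1,2)[OF *, of u] internal_old[OF *(2), of u]
      by (cases "internal ys u"; cases "internal xs u"; cases "prefix u r") auto
    from this[folded of_nat_le_iff[where 'a = ennreal]]
    show "?f ys \<le> ?f xs + indicator {r. prefix u r} r * of_nat (s + 2)"
      by (simp add: indicator_def of_bool_def split: if_splits)
  qed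
  also have "\<dots> \<le> ennreal (real n * path_weight W [] u * (s + 2)) +
      ennreal (path_weight W [] u) * of_nat (s + 2)"
    by (intro add_mono mult_left_mono Suc.IH tree_integral_le_const) auto
  also have "\<dots> = ennreal (real n * path_weight W [] u * (s + 2)) +
      ennreal (path_weight W [] u * (s + 2))"
    using p by (simp add: ennreal_mult ennreal_of_nat_eq_real_of_nat)
  also have "\<dots> = ennreal (real (Suc n) * path_weight W [] u * (s + 2))"
    using p by (simp add: algebra_simps flip: ennreal_plus)
  finally show ?case .
qed simp

text \<open>
  The product \<open>p\<^sub>v p\<^sub>u\<close> for \<open>u = v @ [i]\<close> is what makes the sum over all nodes of a level decay
  geometrically; it comes from the fact that \<open>u\<close> can only become internal once \<open>v\<close> is.
\<close>

lemma tree_integral_internal_count_sq_le: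
  assumes v: "v \<in> lists {..<b}" and i: "i < b"
  defines "u \<equiv> v @ [i]"
  shows "tree_integral n (\<lambda>xs. of_bool (internal xs u) * of_nat ((subtree_count xs u)\<^sup>2))
    \<le> ennreal (real n ^ 2 * (path_weight W [] v * path_weight W [] u) * (s + 3)\<^sup>2)"
proof (induction n)
  case (Suc n)
  define p q where "p = path_weight W [] u" and "q = path_weight W [] v"
  have u: "u \<in> lists {..<b}"
    using v i by (simp add: u_def)
  have p: "0 \<le> p" "p \<le> q"
    using u v i path_weight_nonneg[of "[]" u] path_weight_snoc_le[of v i]
    by (auto simp: p_def q_def u_def)
  let ?f = "\<lambda>xs. of_bool (internal xs u) * of_nat ((subtree_count xs u)\<^sup>2) :: ennreal"
  let ?I = "\<lambda>u xs. of_bool (internal xs u) :: ennreal"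
  \<comment> \<open>The possible increments of the square: \<open>2 N + 1\<close> when an internal
    \<open>u\<close> of size \<open>N\<close> gains a ball, and at most \<open>(s + 1)^2\<close>
    when \<open>u\<close> turns internal, which requires \<open>v\<close> to be internal
    already.\<close>
  let ?h = "\<lambda>xs. (?I u xs * of_nat (subtree_count xs u) * 2 + ?I u xs) + ?I v xs * of_nat ((Suc s)\<^sup>2)"
  have "tree_integral (Suc n) ?f \<le> tree_integral n ?f + ennreal p * tree_integral n ?h"
    unfolding p_def
  proof (rule nn_integral_grow_Suc_le[OF _ u])
    fix xs r ys assume *: "insertion_point b xs r" "insertion_result b s xs r ys"
    have "of_bool (internal ys u) * (subtree_count ys u)\<^sup>2
        \<le> of_bool (internal xs u) * (subtree_count xs u)\<^sup>2 + of_bool (prefix u r) *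
          ((of_bool (internal xs u) * subtree_count xs u * 2 + of_bool (internal xs u))
            + of_bool (internal xs v) * (Suc s)\<^sup>2)"
    proof (cases "internal ys u")
      case True
      show ?thesis
      proof (cases "internal xs u")
        case int: True
        have "(subtree_count ys u)\<^sup>2 \<le> (subtree_count xs u + of_bool (prefix u r))\<^sup>2"
          using internal_old[OF *(2) int] by (rule power_mono) simp
        then show ?thesis
          using int True by (cases "prefix u r") (auto simp: power2_eq_square algebra_simps)
      next
        case False
        have "internal xs v"
          using internal_new(3)[OF * True False, of v] by (simp add: u_def strict_prefix_def)
        then show ?thesis
          using internal_new(1,2)[OF * True False] True False
          by (auto intro: power_mono)
      qed
    qed simp
    from this[folded of_nat_le_iff[where 'a = ennreal]]
    show "?f ys \<le> ?f xs + indicator {r. prefix u r} r * ?h xs"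
      by (simp add: indicator_def of_bool_def split: if_splits)
  qed
  also have "tree_integral n ?h = tree_integral n (\<lambda>xs. ?I u xs * of_nat (subtree_count xs u)) * 2
      + tree_integral n (?I u) + tree_integral n (?I v) * of_nat ((Suc s)\<^sup>2)"
    by (simp add: nn_integral_add nn_integral_multc)
  also have "\<dots> \<le> ennreal (real n * p * (s + 2)) * 2 + ennreal (real n * p)
      + ennreal (real n * q) * of_nat ((Suc s)\<^sup>2)"
    unfolding p_def q_def
    using tree_integral_internal_count_le[OF u] tree_integral_internal_le[OF u]
      tree_integral_internal_le[OF v]
    by (intro add_mono mult_right_mono) auto
  also have "\<dots> = ennreal (real n * p * (s + 2) * 2 + real n * p + real n * q * real ((Suc s)\<^sup>2))"
    using p by (simp add: ennreal_mult' ennreal_of_nat_eq_real_of_nat ennreal_plus del: of_nat_Suc of_nat_power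
        flip: ennreal_numeral)
  \<comment> \<open>Since \<open>p\<close> is at most \<open>q\<close>, the coefficient of
    \<open>n q\<close> is \<open>2 (s + 2) + 1 + (s + 1)^2 = s^2 + 4 s + 6\<close>, which is below
    \<open>(s + 3)^2\<close>.\<close>
  also have "\<dots> \<le> ennreal (real n * q * (s + 3)\<^sup>2)"
  proof (intro ennreal_leI)
    have "real n * p * (s + 2) * 2 + real n * p \<le> real n * q * (2 * (s + 2) + 1)"
    proof -
      have "real n * p * (s + 2) * 2 + real n * p = real n * p * (2 * (s + 2) + 1)"
        by (simp add: algebra_simps)
      then show ?thesis
        using p by (simp add: mult_left_mono mult_right_mono)
    qed
    moreover have "real n * q * (2 * (s + 2) + 1) + real n * q * real ((Suc s)\<^sup>2)
        = real n * q * (real s ^ 2 + 4 * real s + 6)"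
      by (simp add: algebra_simps power2_eq_square)
    moreover have "\<dots> \<le> real n * q * (s + 3)\<^sup>2"
      using p by (intro mult_left_mono) (auto simp: algebra_simps power2_eq_square)
    ultimately show "real n * p * (s + 2) * 2 + real n * p + real n * q * real ((Suc s)\<^sup>2)
        \<le> real n * q * (s + 3)\<^sup>2"
      by linarith
  qed
  finally have "tree_integral (Suc n) ?f
      \<le> tree_integral n ?f + ennreal p * ennreal (real n * q * (s + 3)\<^sup>2)"
    by (meson add_left_mono mult_left_mono order_trans zero_le)
  also have "\<dots> \<le> ennreal (real n ^ 2 * (q * p) * (s + 3)\<^sup>2) + ennreal (p * (real n * q * (s + 3)\<^sup>2))"
    using Suc.IH p by (intro add_mono) (simp_all add: p_def q_def ennreal_mult)
  also have "\<dots> = ennreal ((real n ^ 2 + real n) * ((q * p) * (s + 3)\<^sup>2))"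
    using p by (simp add: algebra_simps flip: ennreal_plus)
  also have "\<dots> \<le> ennreal (real (Suc n) ^ 2 * ((q * p) * (s + 3)\<^sup>2))"
    using p by (intro ennreal_leI mult_right_mono) (auto simp: power2_eq_square algebra_simps)
  finally show ?case
    by (simp add: p_def q_def mult.assoc)
qed simp

end

section \<open>Measurability of the law given the split vectors\<close>

text \<open>All supports lie in one countable set, so each point mass of a bind is a countable sum
  of products of measurable functions. This avoids a sigma-algebra on the type of pmfs. The set
  \<open>S\<close> records where the supports lie, so that continuations have to be kernels only at
  arguments that can occur.\<close>

definition pmf_kernel :: "'m measure \<Rightarrow> 'x set \<Rightarrow> ('m \<Rightarrow> 'x pmf) \<Rightarrow> bool" where
  "pmf_kernel M S K \<longleftrightarrow> (\<exists>C\<subseteq>S. countable C \<and> (\<forall>\<omega>\<in>space M. set_pmf (K \<omega>) \<subseteq> C)) \<and>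
     (\<forall>x. (\<lambda>\<omega>. pmf (K \<omega>) x) \<in> borel_measurable M)"

lemma pmf_kernel_cong:
  "(\<And>\<omega>. \<omega> \<in> space M \<Longrightarrow> K \<omega> = K' \<omega>) \<Longrightarrow> pmf_kernel M S K \<longleftrightarrow> pmf_kernel M S K'"
  unfolding pmf_kernel_def
  by (intro arg_cong2[where f = "(\<and>)"] arg_cong[where f = Ex] arg_cong[where f = All] ext
      ball_cong measurable_cong) (auto intro!: measurable_cong)

lemma pmf_kernel_const: "set_pmf p \<subseteq> S \<Longrightarrow> pmf_kernel M S (\<lambda>_. p)"
  unfolding pmf_kernel_def by (auto intro!: exI[of _ "set_pmf p"])

lemma pmf_kernel_restrict:
  assumes "pmf_kernel M S K" "\<And>\<omega>. \<omega> \<in> space M \<Longrightarrow> set_pmf (K \<omega>) \<subseteq> T"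
  shows "pmf_kernel M T K"
proof -
  obtain C where "countable C" "\<forall>\<omega>\<in>space M. set_pmf (K \<omega>) \<subseteq> C"
    using assms(1) by (auto simp: pmf_kernel_def)
  then have "C \<inter> T \<subseteq> T \<and> countable (C \<inter> T) \<and> (\<forall>\<omega>\<in>space M. set_pmf (K \<omega>) \<subseteq> C \<inter> T)"
    using assms(2) by auto
  then show ?thesis
    using assms(1) unfolding pmf_kernel_def by blast
qed

lemma measurable_nn_integral_count_space:
  assumes "countable C" "\<And>x. x \<in> C \<Longrightarrow> (\<lambda>\<omega>. f \<omega> x) \<in> borel_measurable M"
  shows "(\<lambda>\<omega>. \<integral>\<^sup>+x. f \<omega> x \<partial>count_space C) \<in> borel_measurable M"
proof -
  interpret sigma_finite_measure "count_space C"
    by (rule sigma_finite_measure_count_space_countable) fact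
  have "(\<lambda>(\<omega>, x). f \<omega> x) \<in> borel_measurable (M \<Otimes>\<^sub>M count_space C)"
    unfolding case_prod_beta
    by (rule measurable_compose_countable'[where f = "\<lambda>x p. f (fst p) x" and g = snd and I = C])
      (use assms in \<open>auto intro: measurable_compose[OF measurable_fst]\<close>)
  then show ?thesis
    by (rule borel_measurable_nn_integral)
qed

lemma pmf_kernel_bind:
  assumes p: "pmf_kernel M S p" and f: "\<And>x. x \<in> S \<Longrightarrow> pmf_kernel M T (\<lambda>\<omega>. f \<omega> x)"
  shows "pmf_kernel M T (\<lambda>\<omega>. bind_pmf (p \<omega>) (f \<omega>))"
proof -
  obtain C where C: "C \<subseteq> S" "countable C" "\<And>\<omega>. \<omega> \<in> space M \<Longrightarrow> set_pmf (p \<omega>) \<subseteq> C"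
    using p by (auto simp: pmf_kernel_def)
  have "\<forall>x\<in>C. \<exists>D\<subseteq>T. countable D \<and> (\<forall>\<omega>\<in>space M. set_pmf (f \<omega> x) \<subseteq> D)"
    using f C(1) by (auto simp: pmf_kernel_def)
  then obtain D where D: "\<And>x. x \<in> C \<Longrightarrow> D x \<subseteq> T" "\<And>x. x \<in> C \<Longrightarrow> countable (D x)"
    "\<And>x \<omega>. x \<in> C \<Longrightarrow> \<omega> \<in> space M \<Longrightarrow> set_pmf (f \<omega> x) \<subseteq> D x"
    by (metis bchoice)
  have "(\<Union>x\<in>C. D x) \<subseteq> T \<and> countable (\<Union>x\<in>C. D x) \<and>
      (\<forall>\<omega>\<in>space M. set_pmf (bind_pmf (p \<omega>) (f \<omega>)) \<subseteq> (\<Union>x\<in>C. D x))"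
    using C D by (fastforce simp: set_bind_pmf)
  moreover have "(\<lambda>\<omega>. pmf (bind_pmf (p \<omega>) (f \<omega>)) y) \<in> borel_measurable M" for y
  proof -
    have meas: "(\<lambda>\<omega>. \<integral>\<^sup>+x. ennreal (pmf (p \<omega>) x) * ennreal (pmf (f \<omega> x) y) \<partial>count_space C)
        \<in> borel_measurable M"
    proof (rule measurable_nn_integral_count_space[OF C(2)])
      fix x assume "x \<in> C"
      then have "(\<lambda>\<omega>. pmf (p \<omega>) x) \<in> borel_measurable M" "(\<lambda>\<omega>. pmf (f \<omega> x) y) \<in> borel_measurable M"
        using p f C(1) by (auto simp: pmf_kernel_def)
      then show "(\<lambda>\<omega>. ennreal (pmf (p \<omega>) x) * ennreal (pmf (f \<omega> x) y)) \<in> borel_measurable M"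
        by measurable
    qed
    have "pmf (bind_pmf (p \<omega>) (f \<omega>)) y
        = enn2real (\<integral>\<^sup>+x. ennreal (pmf (p \<omega>) x) * ennreal (pmf (f \<omega> x) y) \<partial>count_space C)"
      if "\<omega> \<in> space M" for \<omega>
    proof -
      have "ennreal (pmf (bind_pmf (p \<omega>) (f \<omega>)) y)
          = (\<integral>\<^sup>+x. ennreal (pmf (p \<omega>) x) * ennreal (pmf (f \<omega> x) y) \<partial>count_space UNIV)"
        by (simp add: ennreal_pmf_bind nn_integral_measure_pmf)
      also have "\<dots> = (\<integral>\<^sup>+x. ennreal (pmf (p \<omega>) x) * ennreal (pmf (f \<omega> x) y) * indicator C x
          \<partial>count_space UNIV)"
      proof (intro nn_integral_cong)
        fix x show "ennreal (pmf (p \<omega>) x) * ennreal (pmf (f \<omega> x) y)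
            = ennreal (pmf (p \<omega>) x) * ennreal (pmf (f \<omega> x) y) * indicator C x"
          using C(3)[OF that] by (cases "x \<in> C") (auto simp: pmf_eq_0_set_pmf)
      qed
      also have "\<dots> = (\<integral>\<^sup>+x. ennreal (pmf (p \<omega>) x) * ennreal (pmf (f \<omega> x) y) \<partial>count_space C)"
        by (simp add: nn_integral_count_space_indicator)
      finally show ?thesis
        by (metis enn2real_ennreal pmf_nonneg)
    qed
    then show ?thesis
      using meas by (subst measurable_cong) auto
  qed
  ultimately show ?thesis
    unfolding pmf_kernel_def by blast
qed

lemma countable_PiE_dflt:
  assumes "finite A" "countable C"
  shows "countable (PiE_dflt A d (\<lambda>_. C))"
proof -
  have "PiE_dflt A d (\<lambda>_. C) \<subseteq> (\<lambda>f x. if x \<in> A then f x else d) ` (A \<rightarrow>\<^sub>E C)"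
  proof
    fix f assume f: "f \<in> PiE_dflt A d (\<lambda>_. C)"
    then have "f = (\<lambda>x. if x \<in> A then restrict f A x else d)"
      by (auto simp: PiE_dflt_def)
    moreover have "restrict f A \<in> A \<rightarrow>\<^sub>E C"
      using f by (auto simp: PiE_dflt_def)
    ultimately show "f \<in> (\<lambda>f x. if x \<in> A then f x else d) ` (A \<rightarrow>\<^sub>E C)"
      by blast
  qed
  then show ?thesis
    using assms by (meson countable_PiE countable_image countable_subset)
qed

lemma pmf_kernel_Pi_pmf:
  assumes "finite A" "pmf_kernel M S p"
  shows "pmf_kernel M UNIV (\<lambda>\<omega>. Pi_pmf A d (\<lambda>_. p \<omega>))"
proof -
  obtain C where C: "countable C" "\<forall>\<omega>\<in>space M. set_pmf (p \<omega>) \<subseteq> C"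
    using assms(2) by (auto simp: pmf_kernel_def)
  have "\<forall>\<omega>\<in>space M. set_pmf (Pi_pmf A d (\<lambda>_. p \<omega>)) \<subseteq> PiE_dflt A d (\<lambda>_. C)"
    using C(2) by (fastforce simp: set_Pi_pmf[OF assms(1)] PiE_dflt_def)
  moreover have "(\<lambda>\<omega>. pmf (p \<omega>) x) \<in> borel_measurable M" for x
    using assms(2) by (simp add: pmf_kernel_def)
  ultimately show ?thesis
    unfolding pmf_kernel_def
    using countable_PiE_dflt[OF assms(1) C(1), of d]
    by (intro conjI exI[of _ "PiE_dflt A d (\<lambda>_. C)"]) (auto simp: pmf_Pi[OF assms(1)])
qed

lemma pmf_kernel_bind_spmf:
  assumes "pmf_kernel M UNIV p" "\<And>\<omega>. \<omega> \<in> space M \<Longrightarrow> set_spmf (p \<omega>) \<subseteq> S"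
    and "\<And>x. x \<in> S \<Longrightarrow> pmf_kernel M UNIV (\<lambda>\<omega>. f \<omega> x)"
  shows "pmf_kernel M UNIV (\<lambda>\<omega>. bind_spmf (p \<omega>) (f \<omega>))"
  unfolding bind_spmf_def
proof (rule pmf_kernel_bind)
  show "pmf_kernel M (insert None (Some ` S)) p"
  proof (rule pmf_kernel_restrict[OF assms(1)])
    fix \<omega> assume "\<omega> \<in> space M"
    then show "set_pmf (p \<omega>) \<subseteq> insert None (Some ` S)"
      using assms(2)[of \<omega>] by (auto simp: in_set_spmf subset_iff) (metis image_eqI option.exhaust)
  qed
  fix x assume "x \<in> insert None (Some ` S)"
  then show "pmf_kernel M UNIV (\<lambda>\<omega>. case x of None \<Rightarrow> return_pmf None | Some a \<Rightarrow> f \<omega> a)"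
    using assms(3) pmf_kernel_const[of "return_pmf None" UNIV M] by auto
qed

lemma pmf_kernel_split_node:
  assumes "pmf_kernel M UNIV (\<lambda>\<omega>. child_pmf b (w \<omega>))"
  shows "pmf_kernel M UNIV (\<lambda>\<omega>. split_node b s0 s1 (w \<omega>) u xs)"
  unfolding split_node_def Let_def
proof (intro pmf_kernel_bind[where S = UNIV] pmf_kernel_const pmf_kernel_Pi_pmf[OF _ assms])
qed auto

lemma pmf_kernel_route:
  assumes "\<And>u. pmf_kernel M UNIV (\<lambda>\<omega>. child_pmf b (W \<omega> u))"
  shows "pmf_kernel M UNIV (\<lambda>\<omega>. route b (W \<omega>) xs u)"
proof -
  obtain m where m: "\<forall>v\<in>set xs. length v \<le> m"
    using finite_nat_set_iff_bounded_le[of "length ` set xs"] by auto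
  show ?thesis
  proof (induction "m - length u" arbitrary: u rule: less_induct)
    case (less u)
    show ?case
    proof (cases "internal xs u")
      case True
      then obtain v where "v \<in> set xs" "strict_prefix u v"
        by (auto simp: internal_iff)
      then have "length u < m"
        using m prefix_length_less[of u v] by fastforce
      then have "pmf_kernel M UNIV (\<lambda>\<omega>. bind_pmf (child_pmf b (W \<omega> u)) (\<lambda>i. route b (W \<omega>) xs (u @ [i])))"
        by (intro pmf_kernel_bind[where S = UNIV] assms less.hyps) auto
      then show ?thesis
        using True by (subst route.simps) simp
    next
      case False
      then show ?thesis
        by (subst route.simps) (simp add: pmf_kernel_const)
    qed
  qed
qed

text \<open>The loop \<open>settle\<close> is replaced by its closed form, which is available only
  at valid configurations and insertion points. This is why supports are restricted to these two
  sets on the way.\<close>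

lemma pmf_kernel_grow:
  assumes W: "\<And>\<omega>. \<omega> \<in> space M \<Longrightarrow> split_process b s s0 s1 (W \<omega>)"
    and child: "\<And>u. pmf_kernel M UNIV (\<lambda>\<omega>. child_pmf b (W \<omega> u))"
  shows "pmf_kernel M UNIV (\<lambda>\<omega>. grow b s s0 s1 (W \<omega>) n)"
proof (induction n)
  case (Suc n)
  have "pmf_kernel M UNIV (\<lambda>\<omega>. add_ball b s s0 s1 (W \<omega>) xs)" if v: "valid_config b s xs" for xs
    unfolding add_ball_def
  proof (rule pmf_kernel_bind_spmf[where S = "{r. insertion_point b xs r}"])
    show "pmf_kernel M UNIV (\<lambda>\<omega>. route b (W \<omega>) xs [])"
      by (rule pmf_kernel_route[OF child])
    show "set_spmf (route b (W \<omega>) xs []) \<subseteq> {r. insertion_point b xs r}" if "\<omega> \<in> space M" for \<omega>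
      using split_process.route_root(2)[OF W[OF that] v] by auto
    fix r assume "r \<in> {r. insertion_point b xs r}"
    then have r: "insertion_point b xs r" by simp
    have "pmf_kernel M UNIV (\<lambda>\<omega>. settle b s s0 s1 (W \<omega>) (xs @ [r])) \<longleftrightarrow>
      pmf_kernel M UNIV (\<lambda>\<omega>. if ball_count xs r < s then return_spmf (xs @ [r])
        else bind_pmf (split_node b s0 s1 (W \<omega> r) r (xs @ [r])) return_spmf)"
      by (intro pmf_kernel_cong split_process.settle_append[OF W v r])
    also have \<dots>
      by (cases "ball_count xs r < s")
        (auto intro!: pmf_kernel_const pmf_kernel_bind[where S = UNIV] pmf_kernel_split_node child)
    finally show "pmf_kernel M UNIV (\<lambda>\<omega>. settle b s s0 s1 (W \<omega>) (xs @ [r]))" .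
  qed
  moreover have "set_spmf (grow b s s0 s1 (W \<omega>) n) \<subseteq> {xs. valid_config b s xs}" if "\<omega> \<in> space M" for \<omega>
    using split_process.grow_valid[OF W[OF that]] by blast
  ultimately show ?case
    unfolding grow.simps using Suc.IH by (intro pmf_kernel_bind_spmf[where S = "{xs. valid_config b s xs}"]) auto
qed (simp add: pmf_kernel_const)

lemma measurable_measure_spmf_kernel:
  fixes K :: "'m \<Rightarrow> 'x :: countable spmf"
  assumes "pmf_kernel M UNIV K"
  shows "(\<lambda>\<omega>. measure_spmf (K \<omega>)) \<in> M \<rightarrow>\<^sub>M subprob_algebra (count_space UNIV)"
proof (rule measurable_subprob_algebra)
  fix A :: "'x set"
  have "(\<lambda>\<omega>. \<integral>\<^sup>+x. ennreal (spmf (K \<omega>) x) \<partial>count_space A) \<in> borel_measurable M"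
    using assms by (intro measurable_nn_integral_count_space) (auto simp: pmf_kernel_def)
  then show "(\<lambda>\<omega>. emeasure (measure_spmf (K \<omega>)) A) \<in> borel_measurable M"
    by (simp add: nn_integral_spmf)
qed (auto intro: measure_spmf.subprob_space_axioms)

section \<open>The law of the split tree\<close>

context split_tree
begin

abbreviation split_vectors :: "(node \<Rightarrow> 'a) measure" where
  "split_vectors \<equiv> Pi\<^sub>M (lists {..<b}) (\<lambda>_. P)"

abbreviation weights :: "(node \<Rightarrow> 'a) \<Rightarrow> node \<Rightarrow> nat \<Rightarrow> real" where
  "weights \<omega> \<equiv> \<lambda>u i. V i (\<omega> u)"

lemma split_process_weights:
  assumes "\<omega> \<in> space split_vectors"
  shows "split_process b s s0 s1 (weights \<omega>)"
proof
  fix u assume "u \<in> lists {..<b}"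
  then have "\<omega> u \<in> space P"
    using assms by (auto simp: space_PiM PiE_def Pi_def)
  then show "split_vector b (weights \<omega> u)"
    using V_nonneg V_sum by (auto simp: split_vector_def)
qed (use s0_ge_1 s0_le s1_le in auto)

lemma pmf_kernel_child:
  "pmf_kernel split_vectors UNIV (\<lambda>\<omega>. child_pmf b (weights \<omega> u))"
proof (cases "u \<in> lists {..<b}")
  case True
  have W: "split_vector b (weights \<omega> u)" if "\<omega> \<in> space split_vectors" for \<omega>
    using split_process.W_split[OF split_process_weights[OF that] True] .
  have "(\<lambda>\<omega>. pmf (child_pmf b (weights \<omega> u)) i) \<in> borel_measurable split_vectors" for i
  proof (cases "i < b")
    case i: True
    have "(\<lambda>\<omega>. V i (\<omega> u)) \<in> borel_measurable split_vectors"
      using V_measurable[OF i] True by (intro measurable_compose[OF measurable_component_singleton]) auto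
    then show ?thesis
      using i by (subst measurable_cong[OF pmf_child_pmf[OF W]]) auto
  next
    case False
    then show ?thesis
      by (subst measurable_cong[OF pmf_child_pmf[OF W]]) auto
  qed
  then show ?thesis
    unfolding pmf_kernel_def using set_child_pmf[OF W]
    by (intro conjI exI[of _ "{..<b}"]) auto
next
  case False
  \<comment> \<open>Outside the index set every point of the product space has the value
    \<open>undefined\<close>, so this kernel is constant.\<close>
  have "pmf_kernel split_vectors UNIV (\<lambda>\<omega>. child_pmf b (weights \<omega> u)) \<longleftrightarrow>
      pmf_kernel split_vectors UNIV (\<lambda>_. child_pmf b (\<lambda>i. V i undefined))"
    using False by (intro pmf_kernel_cong) (auto simp: space_PiM PiE_def extensional_def)
  then show ?thesis
    by (simp add: pmf_kernel_const)
qed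

lemma measurable_grow:
  "(\<lambda>\<omega>. measure_spmf (grow b s s0 s1 (weights \<omega>) n))
    \<in> split_vectors \<rightarrow>\<^sub>M subprob_algebra (count_space UNIV)"
  by (intro measurable_measure_spmf_kernel pmf_kernel_grow split_process_weights pmf_kernel_child)

lemma prob_space_split_vectors: "prob_space split_vectors"
  by (intro prob_space_PiM prob_space_axioms)

lemma nn_integral_split_tree_law:
  "(\<integral>\<^sup>+xs. f xs \<partial>split_tree_law P V b s s0 s1 n)
    = (\<integral>\<^sup>+\<omega>. \<integral>\<^sup>+xs. f xs \<partial>measure_spmf (grow b s s0 s1 (weights \<omega>) n) \<partial>split_vectors)"
  unfolding split_tree_law_def
  by (rule nn_integral_bind[OF _ measurable_grow]) simp

lemma space_split_tree_law: "space (split_tree_law P V b s s0 s1 n) = UNIV"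
  and sets_split_tree_law: "sets (split_tree_law P V b s s0 s1 n) = UNIV"
proof -
  interpret sv: prob_space split_vectors
    by (rule prob_space_split_vectors)
  show "space (split_tree_law P V b s s0 s1 n) = UNIV"
    unfolding split_tree_law_def using space_bind_measurable[OF measurable_grow sv.not_empty] by simp
  show "sets (split_tree_law P V b s s0 s1 n) = UNIV"
    unfolding split_tree_law_def using sets_bind_measurable[OF measurable_grow sv.not_empty] by simp
qed

text \<open>Transfers statements about all valid configurations to the law. Through it the lower
  bound gets probability exactly 1 for large \<open>n\<close>, not merely in the limit.\<close>

lemma prob_split_tree_law_eq_1:
  assumes "\<And>xs. valid_config b s xs \<Longrightarrow> length xs = n \<Longrightarrow> Q xs"
  shows "\<P>(xs in split_tree_law P V b s s0 s1 n. Q xs) = 1"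
proof -
  interpret sv: prob_space split_vectors
    by (rule prob_space_split_vectors)
  have "emeasure (split_tree_law P V b s s0 s1 n) {xs. Q xs}
      = (\<integral>\<^sup>+xs. indicator {xs. Q xs} xs \<partial>split_tree_law P V b s s0 s1 n)"
    by (simp add: sets_split_tree_law)
  also have "\<dots> = (\<integral>\<^sup>+\<omega>. 1 \<partial>split_vectors)"
    unfolding nn_integral_split_tree_law
  proof (intro nn_integral_cong)
    fix \<omega> assume "\<omega> \<in> space split_vectors"
    then have *: "lossless_spmf (grow b s s0 s1 (weights \<omega>) n)"
        "\<And>xs. xs \<in> set_spmf (grow b s s0 s1 (weights \<omega>) n) \<Longrightarrow> Q xs"
      using split_process.grow_valid[OF split_process_weights] assms by blast+
    have "(\<integral>\<^sup>+xs. indicator {xs. Q xs} xs \<partial>measure_spmf (grow b s s0 s1 (weights \<omega>) n))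
        = (\<integral>\<^sup>+xs. 1 \<partial>measure_spmf (grow b s s0 s1 (weights \<omega>) n))"
      by (intro nn_integral_cong_AE) (auto simp: AE_measure_spmf_iff *(2))
    then show "(\<integral>\<^sup>+xs. indicator {xs. Q xs} xs \<partial>measure_spmf (grow b s s0 s1 (weights \<omega>) n)) = 1"
      using *(1) by (simp add: lossless_spmf_def weight_spmf_def measure_spmf.emeasure_eq_measure space_measure_spmf)
  qed
  also have "\<dots> = 1"
    by (simp add: sv.emeasure_space_1)
  finally show ?thesis
    by (simp add: measure_def space_split_tree_law)
qed

end

section \<open>Common ancestors of two balls\<close>

text \<open>For \<open>x = y\<close> this is the depth of \<open>x\<close>, so one quantity covers
  the ancestors of a single ball and the common ancestors of two.\<close>

definition common_depth :: "node \<Rightarrow> node \<Rightarrow> nat" where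
  "common_depth x y = card {u. strict_prefix u x \<and> strict_prefix u y}"

definition ancestor_moment :: "real \<Rightarrow> config \<Rightarrow> real" where
  "ancestor_moment z xs =
     (\<Sum>i<length xs. \<Sum>j<length xs. z ^ common_depth (xs ! i) (xs ! j))"

lemma finite_strict_prefixes [simp]: "finite {u. strict_prefix u x}"
  by (rule finite_subset[of _ "set (prefixes x)"]) (auto simp: strict_prefix_def)

text \<open>Common proper ancestors form a chain closed under prefixes, so their lengths fill an
  initial segment of the naturals.\<close>

lemma bij_betw_length_common:
  "bij_betw length {u. strict_prefix u x \<and> strict_prefix u y} {..<common_depth x y}"
proof -
  let ?C = "{u. strict_prefix u x \<and> strict_prefix u y}"
  have fin: "finite ?C"
    by (rule finite_subset[OF _ finite_strict_prefixes[of x]]) auto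
  have inj: "inj_on length ?C"
  proof (rule inj_onI)
    fix u v assume "u \<in> ?C" "v \<in> ?C" "length u = length v"
    then show "u = v"
      by (auto simp: strict_prefix_def prefix_def)
  qed
  have down: "k \<in> length ` ?C" if "l \<in> length ` ?C" "k \<le> l" for k l
  proof -
    from \<open>l \<in> length ` ?C\<close> obtain u where u: "u \<in> ?C" "l = length u"
      by blast
    have "take k u \<in> ?C"
      using u(1) take_is_prefix[of k u] by (auto intro: prefix_order.le_less_trans)
    moreover have "length (take k u) = k"
      using u(2) that(2) by simp
    ultimately show ?thesis
      by (metis image_eqI)
  qed
  define m where "m = (LEAST m. m \<notin> length ` ?C)"
  have "\<exists>m. m \<notin> length ` ?C"
    using fin ex_new_if_finite[OF infinite_UNIV_nat, of "length ` ?C"] by auto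
  then have "m \<notin> length ` ?C"
    unfolding m_def by (rule LeastI_ex)
  moreover have "k \<in> length ` ?C" if "k < m" for k
    using not_less_Least[of k "\<lambda>m. m \<notin> length ` ?C"] that by (auto simp: m_def)
  moreover have "k < m" if "k \<in> length ` ?C" for k
    using down[OF that, of m] \<open>m \<notin> length ` ?C\<close> by (cases "k < m") auto
  ultimately have "length ` ?C = {..<m}"
    by blast
  then have "bij_betw length ?C {..<m}"
    using inj by (simp add: bij_betw_def)
  moreover from this have "common_depth x y = m"
    using bij_betw_same_card by (fastforce simp: common_depth_def)
  ultimately show ?thesis by simp
qed

text \<open>The geometric sum makes the exponential additive over the common ancestors, so that the
  sum over pairs of balls can be interchanged with a sum over nodes.\<close>

lemma power_common_depth:
  fixes z :: real
  shows "z ^ common_depth x y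
    = 1 + (z - 1) * (\<Sum>u | strict_prefix u x \<and> strict_prefix u y. z ^ length u)"
proof -
  have "(\<Sum>u | strict_prefix u x \<and> strict_prefix u y. z ^ length u) = (\<Sum>k<common_depth x y. z ^ k)"
    by (rule sum.reindex_bij_betw[OF bij_betw_length_common])
  then show ?thesis
    using power_diff_1_eq[of z "common_depth x y"] by simp
qed

lemma finite_internal: "finite {u. internal xs u}"
  by (rule finite_subset[of _ "\<Union>x\<in>set xs. {u. strict_prefix u x}"]) (auto simp: internal_iff)

text \<open>After the interchange, a node contributes once per ordered pair of balls strictly below
  it, hence with the square of their number. Nodes with a ball strictly below them are the internal
  ones.\<close>

lemma ancestor_moment_le:
  assumes "1 \<le> z"
  shows "ancestor_moment z xs
    \<le> real (length xs) ^ 2 + (z - 1) * (\<Sum>u | internal xs u. z ^ length u * real (subtree_count xs u) ^ 2)"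
proof -
  let ?S = "{u. internal xs u}"
  let ?a = "\<lambda>u i. of_bool (strict_prefix u (xs ! i)) :: real"
  have S: "finite ?S"
    by (rule finite_internal)
  have *: "(\<Sum>u | strict_prefix u (xs ! i) \<and> strict_prefix u (xs ! j). z ^ length u)
      = (\<Sum>u\<in>?S. z ^ length u * (?a u i * ?a u j))" if "i < length xs" for i j
    using that by (intro sum.mono_neutral_cong_left[OF S]) (auto simp: internal_iff)
  have "ancestor_moment z xs = (\<Sum>i<length xs. \<Sum>j<length xs. 1) +
      (z - 1) * (\<Sum>i<length xs. \<Sum>j<length xs. \<Sum>u\<in>?S. z ^ length u * (?a u i * ?a u j))"
    unfolding ancestor_moment_def power_common_depth
    by (simp add: * sum.distrib flip: sum_distrib_left)
  also have "(\<Sum>i<length xs. \<Sum>j<length xs. \<Sum>u\<in>?S. z ^ length u * (?a u i * ?a u j))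
      = (\<Sum>u\<in>?S. z ^ length u * (\<Sum>i<length xs. ?a u i) ^ 2)"
  proof -
    have "(\<Sum>i<length xs. \<Sum>j<length xs. \<Sum>u\<in>?S. z ^ length u * (?a u i * ?a u j))
        = (\<Sum>i<length xs. \<Sum>u\<in>?S. \<Sum>j<length xs. z ^ length u * (?a u i * ?a u j))"
      by (intro sum.cong refl sum.swap)
    also have "\<dots> = (\<Sum>u\<in>?S. \<Sum>i<length xs. \<Sum>j<length xs. z ^ length u * (?a u i * ?a u j))"
      by (rule sum.swap)
    finally show ?thesis
      unfolding power2_eq_square sum_product unfolding sum_distrib_left .
  qed
  also have "\<dots> \<le> (\<Sum>u\<in>?S. z ^ length u * real (subtree_count xs u) ^ 2)"
  proof (intro sum_mono mult_left_mono power_mono)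
    fix u
    have "(\<Sum>i<length xs. ?a u i) = real (card {i. i < length xs \<and> strict_prefix u (xs ! i)})"
      by (simp add: Int_def)
    also have "\<dots> \<le> real (subtree_count xs u)"
      unfolding subtree_count_def by (intro of_nat_mono card_mono) (auto simp: strict_prefix_def)
    finally show "(\<Sum>i<length xs. ?a u i) \<le> real (subtree_count xs u)" .
  qed (use assms in \<open>auto intro: sum_nonneg\<close>)
  finally show ?thesis
    using assms by (simp add: power2_eq_square mult_left_mono)
qed

section \<open>Grouping the nodes by level\<close>

definition level :: "nat \<Rightarrow> nat \<Rightarrow> node set" where
  "level b k = {u \<in> lists {..<b}. length u = k}"

lemma finite_level [simp]: "finite (level b k)"
  using finite_lists_length_eq[of "{..<b}" k] by (simp add: level_def lists_eq_set conj_commute)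

lemma level_0: "level b 0 = {[]}"
  by (auto simp: level_def)

lemma sum_level_Suc:
  fixes F :: "node \<Rightarrow> 'c :: comm_monoid_add"
  shows "(\<Sum>u\<in>level b (Suc k). F u) = (\<Sum>v\<in>level b k. \<Sum>i<b. F (v @ [i]))"
proof -
  have "level b (Suc k) = (\<lambda>(v, i). v @ [i]) ` (level b k \<times> {..<b})"
  proof (intro equalityI subsetI)
    fix u assume "u \<in> level b (Suc k)"
    then show "u \<in> (\<lambda>(v, i). v @ [i]) ` (level b k \<times> {..<b})"
      by (cases u rule: rev_cases) (auto simp: level_def image_iff)
  qed (auto simp: level_def)
  then show ?thesis
    by (simp add: sum.reindex inj_on_def split_def sum.cartesian_product)
qed

lemma sum_level_prod_list:
  fixes e :: "nat \<Rightarrow> 'c :: comm_semiring_1"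
  shows "(\<Sum>v\<in>level b k. prod_list (map e v)) = (\<Sum>i<b. e i) ^ k"
proof (induction k)
  case (Suc k)
  have "(\<Sum>v\<in>level b (Suc k). prod_list (map e v)) = (\<Sum>v\<in>level b k. prod_list (map e v)) * (\<Sum>i<b. e i)"
    by (simp add: sum_level_Suc sum_product)
  then show ?case
    using Suc.IH by (simp add: mult.commute)
qed (simp add: level_0)

text \<open>The height varies with \<open>xs\<close>. As a series over all levels in
  \<open>ennreal\<close>, the bound can be integrated term by term.\<close>

lemma ancestor_moment_le_suminf:
  assumes z: "1 \<le> z" and xs: "valid_config b s xs"
  shows "ennreal (ancestor_moment z xs) \<le> ennreal (real (length xs) ^ 2) + ennreal (z - 1) *
    (\<Sum>k. \<Sum>u\<in>level b k. ennreal (z ^ k) * (of_bool (internal xs u) * of_nat ((subtree_count xs u)\<^sup>2)))"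
proof -
  let ?g = "\<lambda>k. \<Sum>u\<in>level b k. ennreal (z ^ k) * (of_bool (internal xs u) * of_nat ((subtree_count xs u)\<^sup>2))"
  have "internal xs u \<Longrightarrow> u \<in> lists {..<b}" for u
    using xs by (auto simp: valid_config_def internal_iff strict_prefix_def prefix_def dest!: subsetD)
  moreover obtain K where K: "\<forall>u\<in>{u. internal xs u}. length u < K"
    using finite_nat_set_iff_bounded[of "length ` {u. internal xs u}"] finite_internal by auto
  ultimately have S: "{u. internal xs u} \<subseteq> (\<Union>k<K. level b k)"
    by (auto simp: level_def)
  have "(\<Sum>u | internal xs u. z ^ length u * real (subtree_count xs u) ^ 2)
      = (\<Sum>u\<in>(\<Union>k<K. level b k). z ^ length u * (of_bool (internal xs u) * real ((subtree_count xs u)\<^sup>2)))"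
    using S by (intro sum.mono_neutral_cong_left) auto
  also have "\<dots> = (\<Sum>k<K. \<Sum>u\<in>level b k. z ^ length u * (of_bool (internal xs u) * real ((subtree_count xs u)\<^sup>2)))"
    using finite_level[of b, unfolded level_def] by (intro sum.UNION_disjoint) (auto simp: level_def)
  also have "\<dots> = (\<Sum>k<K. \<Sum>u\<in>level b k. z ^ k * (of_bool (internal xs u) * real ((subtree_count xs u)\<^sup>2)))"
    by (simp add: level_def)
  also have "ennreal \<dots> = (\<Sum>k<K. \<Sum>u\<in>level b k.
      ennreal (z ^ k * (of_bool (internal xs u) * real ((subtree_count xs u)\<^sup>2))))"
    using z by (simp add: sum_nonneg)
  also have "\<dots> = (\<Sum>k<K. ?g k)"
  proof -
    have "ennreal (a * (of_bool Q * real N)) = ennreal a * (of_bool Q * of_nat N)"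
      if "0 \<le> a" for a Q N
      using that ennreal_mult'[of "real N" a] by (cases Q) (simp_all add: ennreal_of_nat_eq_real_of_nat mult.commute)
    note * = this
    show ?thesis
      by (intro sum.cong refl *) (use z in simp)
  qed
  also have "\<dots> \<le> (\<Sum>k. ?g k)"
    by (rule sum_le_suminf) auto
  finally have "ennreal (\<Sum>u | internal xs u. z ^ length u * real (subtree_count xs u) ^ 2) \<le> (\<Sum>k. ?g k)" .
  then have "ennreal (z - 1) * ennreal (\<Sum>u | internal xs u. z ^ length u * real (subtree_count xs u) ^ 2)
      \<le> ennreal (z - 1) * (\<Sum>k. ?g k)"
    by (rule mult_left_mono) simp
  moreover have "ennreal (ancestor_moment z xs) \<le> ennreal (real (length xs) ^ 2) +
      ennreal (z - 1) * ennreal (\<Sum>u | internal xs u. z ^ length u * real (subtree_count xs u) ^ 2)"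
    using ancestor_moment_le[OF z, of xs] z
    by (simp add: ennreal_mult'[symmetric] ennreal_plus[symmetric] sum_nonneg ennreal_leI del: ennreal_plus)
  ultimately show ?thesis
    by (meson add_left_mono order_trans)
qed

section \<open>Averaging over the split vectors\<close>

text \<open>Independence for an infinite index set, reduced to the finite product over the
  coordinates that occur.\<close>

lemma (in product_prob_space) nn_integral_PiM_prod:
  assumes "finite J" "J \<subseteq> I" "\<And>i. i \<in> J \<Longrightarrow> f i \<in> borel_measurable (M i)"
  shows "(\<integral>\<^sup>+\<omega>. (\<Prod>i\<in>J. f i (\<omega> i)) \<partial>Pi\<^sub>M I M) = (\<Prod>i\<in>J. \<integral>\<^sup>+x. f i x \<partial>M i)"
proof -
  have "(\<integral>\<^sup>+\<omega>. (\<Prod>i\<in>J. f i (\<omega> i)) \<partial>Pi\<^sub>M I M)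
      = (\<integral>\<^sup>+\<omega>. (\<Prod>i\<in>J. f i (restrict \<omega> J i)) \<partial>Pi\<^sub>M I M)"
    by (intro nn_integral_cong prod.cong) auto
  also have "\<dots> = (\<integral>\<^sup>+y. (\<Prod>i\<in>J. f i (y i)) \<partial>distr (Pi\<^sub>M I M) (Pi\<^sub>M J M) (\<lambda>\<omega>. restrict \<omega> J))"
    using assms by (subst nn_integral_distr) (auto intro!: measurable_restrict_subset borel_measurable_prod
        intro: measurable_compose[OF measurable_component_singleton])
  also have "distr (Pi\<^sub>M I M) (Pi\<^sub>M J M) (\<lambda>\<omega>. restrict \<omega> J) = Pi\<^sub>M J M"
    using assms by (intro distr_PiM_restrict_finite)
  also have "(\<integral>\<^sup>+y. (\<Prod>i\<in>J. f i (y i)) \<partial>Pi\<^sub>M J M) = (\<Prod>i\<in>J. \<integral>\<^sup>+x. f i x \<partial>M i)"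
    using assms by (intro product_nn_integral_prod)
  finally show ?thesis .
qed

context split_tree
begin

definition mean_square :: real where
  "mean_square = (\<integral>x. (\<Sum>i<b. (V i x)\<^sup>2) \<partial>P)"

lemma V_le_1:
  assumes "i < b" "x \<in> space P"
  shows "V i x \<le> 1"
proof -
  have "V i x \<le> (\<Sum>i<b. V i x)"
    by (rule member_le_sum) (use assms V_nonneg in auto)
  then show ?thesis
    using V_sum assms by simp
qed

lemma sum_square_le_1:
  assumes "x \<in> space P"
  shows "(\<Sum>i<b. (V i x)\<^sup>2) \<le> 1"
proof -
  have "(\<Sum>i<b. (V i x)\<^sup>2) \<le> (\<Sum>i<b. V i x)"
    using V_nonneg V_le_1 assms by (intro sum_mono) (auto simp: power2_eq_square mult_left_le)
  then show ?thesis
    using V_sum[OF assms] by simp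
qed

lemma measurable_sum_square: "(\<lambda>x. \<Sum>i<b. (V i x)\<^sup>2) \<in> borel_measurable P"
  using V_measurable by (intro borel_measurable_sum borel_measurable_power) auto

lemma integrable_sum_square: "integrable P (\<lambda>x. \<Sum>i<b. (V i x)\<^sup>2)"
  by (rule integrable_const_bound[where B = 1])
    (use sum_square_le_1 measurable_sum_square in \<open>auto intro!: AE_I2 simp: sum_nonneg\<close>)

lemma mean_square_nonneg: "0 \<le> mean_square"
  unfolding mean_square_def by (intro integral_nonneg_AE AE_I2) (simp add: sum_nonneg)

text \<open>The sum of the squares is at most the sum of the components, which is 1. Equality forces
  every component to be 0 or 1, hence some component to be 1, and by assumption this does not happen
  almost surely.\<close>

lemma mean_square_less_1: "mean_square < 1"
proof -
  let ?g = "\<lambda>x. 1 - (\<Sum>i<b. (V i x)\<^sup>2)"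
  have int: "integrable P ?g"
    using integrable_sum_square by simp
  have g: "(\<integral>x. ?g x \<partial>P) = 1 - mean_square"
    unfolding mean_square_def using integrable_sum_square
    by (subst Bochner_Integration.integral_diff) (auto simp: prob_space)
  have nn: "AE x in P. 0 \<le> ?g x"
    using sum_square_le_1 by (intro AE_I2) simp
  have "mean_square \<noteq> 1"
  proof
    assume "mean_square = 1"
    then have "AE x in P. ?g x = 0"
      using integral_nonneg_eq_0_iff_AE[OF int nn] g by simp
    then have ae: "AE x in P. \<exists>i<b. V i x = 1"
    proof (rule AE_mp, intro AE_I2 impI)
      fix x assume x: "x \<in> space P" "?g x = 0"
      have "(\<Sum>i<b. V i x - (V i x)\<^sup>2) = 0"
        using x V_sum by (simp add: sum_subtractf)
      moreover have "0 \<le> V i x - (V i x)\<^sup>2" if "i < b" for i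
        using V_nonneg[OF that x(1)] V_le_1[OF that x(1)] by (simp add: power2_eq_square mult_left_le)
      ultimately have "V i x - (V i x)\<^sup>2 = 0" if "i < b" for i
        using that by (subst (asm) sum_nonneg_eq_0_iff) auto
      then have "V i x = 0 \<or> V i x = 1" if "i < b" for i
        using that by (auto simp: power2_eq_square algebra_simps)
      then show "\<exists>i<b. V i x = 1"
        using V_sum[OF x(1)] by (metis lessThan_iff sum.neutral zero_neq_one)
    qed
    have "{x \<in> space P. \<exists>i<b. V i x = 1} \<in> sets P"
    proof -
      have "{x \<in> space P. \<exists>i<b. V i x = 1} = (\<Union>i<b. {x \<in> space P. V i x = 1})"
        by auto
      also have "\<dots> \<in> sets P"
        using V_measurable by (intro sets.finite_UN) auto
      finally show ?thesis .
    qed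
    moreover have "AE x in P. x \<in> {x \<in> space P. \<exists>i<b. V i x = 1}"
      using ae AE_space by eventually_elim simp
    ultimately have "\<P>(x in P. \<exists>i<b. V i x = 1) = 1"
      by (subst prob_eq_1)
    then show False
      using V_nontrivial by simp
  qed
  moreover have "0 \<le> 1 - mean_square"
    unfolding g[symmetric] using nn by (rule integral_nonneg_AE)
  ultimately show ?thesis by simp
qed

text \<open>The proper prefixes of \<open>v\<close> are distinct nodes, so the split vectors along
  the path are independent. The length of a prefix tells which component of its vector is used,
  hence the index \<open>v ! length u\<close>.\<close>

lemma nn_integral_path_weight_square:
  assumes v: "v \<in> lists {..<b}"
  shows "(\<integral>\<^sup>+\<omega>. ennreal ((path_weight (weights \<omega>) [] v)\<^sup>2) \<partial>split_vectors)
    = prod_list (map (\<lambda>i. \<integral>\<^sup>+x. ennreal ((V i x)\<^sup>2) \<partial>P) v)"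
proof -
  interpret PP: product_prob_space "\<lambda>_. P" "lists {..<b}"
    by unfold_locales
  let ?J = "(\<lambda>k. take k v) ` {..<length v}"
  have inj: "inj_on (\<lambda>k. take k v) {..<length v}"
    by (intro inj_onI) (metis length_take lessThan_iff min.strict_order_iff min.absorb4)
  have vk: "v ! k < b" if "k < length v" for k
    using v that by (auto simp: in_listsp_conv_set subset_iff dest: nth_mem)
  have "(\<integral>\<^sup>+\<omega>. ennreal ((path_weight (weights \<omega>) [] v)\<^sup>2) \<partial>split_vectors)
      = (\<integral>\<^sup>+\<omega>. (\<Prod>u\<in>?J. ennreal ((V (v ! length u) (\<omega> u))\<^sup>2)) \<partial>split_vectors)"
    by (intro nn_integral_cong)
      (simp add: path_weight_def prod_power_distrib prod_ennreal prod.reindex[OF inj])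
  also have "\<dots> = (\<Prod>u\<in>?J. \<integral>\<^sup>+x. ennreal ((V (v ! length u) x)\<^sup>2) \<partial>P)"
  proof (rule PP.nn_integral_PiM_prod)
    show "?J \<subseteq> lists {..<b}"
      using v by (auto dest: in_set_takeD)
    show "(\<lambda>x. ennreal ((V (v ! length u) x)\<^sup>2)) \<in> borel_measurable P" if "u \<in> ?J" for u
      using that vk V_measurable by (auto simp: min_absorb2)
  qed simp
  also have "\<dots> = (\<Prod>k<length v. \<integral>\<^sup>+x. ennreal ((V (v ! k) x)\<^sup>2) \<partial>P)"
    by (simp add: prod.reindex[OF inj])
  also have "\<dots> = prod_list (map (\<lambda>i. \<integral>\<^sup>+x. ennreal ((V i x)\<^sup>2) \<partial>P) v)"
    by (simp add: prod.list_conv_set_nth atLeast0LessThan)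
  finally show ?thesis .
qed

lemma measurable_path_weight:
  assumes v: "v \<in> lists {..<b}"
  shows "(\<lambda>\<omega>. path_weight (weights \<omega>) [] v) \<in> borel_measurable split_vectors"
  unfolding path_weight_def
proof (intro borel_measurable_prod)
  fix k assume k: "k \<in> {..<length v}"
  then have "v ! k < b" "[] @ take k v \<in> lists {..<b}"
    using v by (auto simp: in_listsp_conv_set subset_iff dest: nth_mem in_set_takeD)
  then show "(\<lambda>\<omega>. V (v ! k) (\<omega> ([] @ take k v))) \<in> borel_measurable split_vectors"
    using V_measurable by (intro measurable_compose[OF measurable_component_singleton]) auto
qed

text \<open>Words of length \<open>k\<close> index the terms obtained by expanding the
  \<open>k\<close>-th power of the sum of the second moments.\<close>

lemma sum_level_path_weight_square:
  "(\<Sum>v\<in>level b k. \<integral>\<^sup>+\<omega>. ennreal ((path_weight (weights \<omega>) [] v)\<^sup>2) \<partial>split_vectors)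
    = ennreal (mean_square ^ k)"
proof -
  have "(\<Sum>v\<in>level b k. \<integral>\<^sup>+\<omega>. ennreal ((path_weight (weights \<omega>) [] v)\<^sup>2) \<partial>split_vectors)
      = (\<Sum>v\<in>level b k. prod_list (map (\<lambda>i. \<integral>\<^sup>+x. ennreal ((V i x)\<^sup>2) \<partial>P) v))"
    by (intro sum.cong refl nn_integral_path_weight_square) (simp add: level_def)
  also have "\<dots> = (\<Sum>i<b. \<integral>\<^sup>+x. ennreal ((V i x)\<^sup>2) \<partial>P) ^ k"
    by (rule sum_level_prod_list)
  also have "(\<Sum>i<b. \<integral>\<^sup>+x. ennreal ((V i x)\<^sup>2) \<partial>P) = (\<integral>\<^sup>+x. ennreal (\<Sum>i<b. (V i x)\<^sup>2) \<partial>P)"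
    using V_measurable by (subst nn_integral_sum[symmetric]) (auto simp: sum_ennreal)
  also have "\<dots> = ennreal mean_square"
    unfolding mean_square_def
    by (intro nn_integral_eq_integral integrable_sum_square AE_I2) (simp add: sum_nonneg)
  finally show ?thesis
    by (simp add: ennreal_power mean_square_nonneg)
qed

lemma borel_measurable_split_tree_law [simp]:
  "(f :: config \<Rightarrow> ennreal) \<in> borel_measurable (split_tree_law P V b s s0 s1 n)"
  by (simp add: measurable_def sets_split_tree_law space_split_tree_law)

lemma nn_integral_law_mono:
  assumes "\<And>xs. valid_config b s xs \<Longrightarrow> length xs = n \<Longrightarrow> f xs \<le> g xs"
  shows "(\<integral>\<^sup>+xs. f xs \<partial>split_tree_law P V b s s0 s1 n) \<le> (\<integral>\<^sup>+xs. g xs \<partial>split_tree_law P V b s s0 s1 n)"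
  unfolding nn_integral_split_tree_law
proof (rule nn_integral_mono)
  fix \<omega> assume "\<omega> \<in> space split_vectors"
  then have "valid_config b s xs \<and> length xs = n" if "xs \<in> set_spmf (grow b s s0 s1 (weights \<omega>) n)" for xs
    using split_process.grow_valid[OF split_process_weights] that by blast
  then show "(\<integral>\<^sup>+xs. f xs \<partial>measure_spmf (grow b s s0 s1 (weights \<omega>) n))
      \<le> (\<integral>\<^sup>+xs. g xs \<partial>measure_spmf (grow b s s0 s1 (weights \<omega>) n))"
    using assms by (intro nn_integral_mono_AE) (auto simp: AE_measure_spmf_iff)
qed

lemma emeasure_split_tree_law_UNIV [simp]: "emeasure (split_tree_law P V b s s0 s1 n) UNIV = 1"
proof -
  have "measure (split_tree_law P V b s s0 s1 n) UNIV = 1"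
    using prob_split_tree_law_eq_1[of n "\<lambda>_. True"] by (simp add: space_split_tree_law)
  then show ?thesis
    by (metis emeasure_eq_ennreal_measure ennreal_1 measure_zero_top zero_neq_one)
qed

text \<open>The level is \<open>Suc k\<close> because the estimate for a node refers to its parent;
  the root is treated separately.\<close>

lemma level_moment_le:
  "(\<integral>\<^sup>+xs. (\<Sum>u\<in>level b (Suc k). of_bool (internal xs u) * of_nat ((subtree_count xs u)\<^sup>2))
      \<partial>split_tree_law P V b s s0 s1 n)
    \<le> ennreal (real n ^ 2 * (s + 3)\<^sup>2 * mean_square ^ k)"
proof -
  let ?f = "\<lambda>u xs. of_bool (internal xs u) * of_nat ((subtree_count xs u)\<^sup>2) :: ennreal"
  let ?c = "real n ^ 2 * (s + 3)\<^sup>2"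
  have "(\<integral>\<^sup>+xs. (\<Sum>u\<in>level b (Suc k). ?f u xs) \<partial>split_tree_law P V b s s0 s1 n)
      \<le> (\<integral>\<^sup>+\<omega>. (\<Sum>v\<in>level b k. ennreal ?c * ennreal ((path_weight (weights \<omega>) [] v)\<^sup>2)) \<partial>split_vectors)"
    unfolding nn_integral_split_tree_law
  proof (intro nn_integral_mono)
    fix \<omega> assume w: "\<omega> \<in> space split_vectors"
    interpret split_process b s s0 s1 "weights \<omega>"
      by (rule split_process_weights[OF w])
    have "tree_integral n (\<lambda>xs. \<Sum>u\<in>level b (Suc k). ?f u xs) = (\<Sum>u\<in>level b (Suc k). tree_integral n (?f u))"
      by (rule nn_integral_sum) simp
    also have "\<dots> = (\<Sum>v\<in>level b k. \<Sum>i<b. tree_integral n (?f (v @ [i])))"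
      by (rule sum_level_Suc)
    also have "\<dots> \<le> (\<Sum>v\<in>level b k. ennreal ?c * ennreal ((path_weight (weights \<omega>) [] v)\<^sup>2))"
    proof (intro sum_mono)
      fix v assume "v \<in> level b k"
      then have v: "v \<in> lists {..<b}"
        by (simp add: level_def)
      define p where "p = path_weight (weights \<omega>) [] v"
      have p: "0 \<le> p"
        using v by (auto simp: p_def intro: path_weight_nonneg)
      have wv: "(\<Sum>i<b. weights \<omega> v i) = 1" "\<And>i. i < b \<Longrightarrow> 0 \<le> weights \<omega> v i"
        using W_split[OF v] by (auto simp: split_vector_def)
      have "(\<Sum>i<b. tree_integral n (?f (v @ [i])))
          \<le> (\<Sum>i<b. ennreal (?c * p\<^sup>2 * weights \<omega> v i))"
      proof (intro sum_mono)
        fix i assume "i \<in> {..<b}"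
        then show "tree_integral n (?f (v @ [i])) \<le> ennreal (?c * p\<^sup>2 * weights \<omega> v i)"
          using tree_integral_internal_count_sq_le[OF v, of i n]
          by (simp add: path_weight_snoc p_def power2_eq_square mult_ac)
      qed
      also have "\<dots> = ennreal (\<Sum>i<b. ?c * p\<^sup>2 * weights \<omega> v i)"
        using wv by (intro sum_ennreal) auto
      \<comment> \<open>The weights of the children of \<open>v\<close> sum to 1, so the products of
        the weights of \<open>v\<close> and its children add up to \<open>p\<^sup>2\<close>.\<close>
      also have "(\<Sum>i<b. ?c * p\<^sup>2 * weights \<omega> v i) = ?c * p\<^sup>2"
        by (simp add: wv flip: sum_distrib_left)
      finally show "(\<Sum>i<b. tree_integral n (?f (v @ [i])))
          \<le> ennreal ?c * ennreal ((path_weight (weights \<omega>) [] v)\<^sup>2)"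
        by (simp add: p_def ennreal_mult')
    qed
    finally show "tree_integral n (\<lambda>xs. \<Sum>u\<in>level b (Suc k). ?f u xs)
        \<le> (\<Sum>v\<in>level b k. ennreal ?c * ennreal ((path_weight (weights \<omega>) [] v)\<^sup>2))" .
  qed
  also have "\<dots> = ennreal ?c *
      (\<Sum>v\<in>level b k. \<integral>\<^sup>+\<omega>. ennreal ((path_weight (weights \<omega>) [] v)\<^sup>2) \<partial>split_vectors)"
    using measurable_path_weight
    by (subst nn_integral_sum) (auto simp: level_def nn_integral_cmult sum_distrib_left)
  also have "\<dots> = ennreal (?c * mean_square ^ k)"
    unfolding sum_level_path_weight_square by (simp add: ennreal_mult')
  finally show ?thesis .
qed

lemma ancestor_moment_bound:
  "\<exists>z C. 1 < z \<and> 0 < C \<and> (\<forall>n. (\<integral>\<^sup>+xs. ennreal (ancestor_moment z xs) \<partial>split_tree_law P V b s s0 s1 n)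
    \<le> ennreal (C * real n ^ 2))"
proof -
  \<comment> \<open>The reciprocal of \<open>z\<close> is the midpoint between
    \<open>mean_square\<close> and 1, which gives \<open>z > 1\<close> and
    \<open>z * mean_square < 1\<close>.\<close>
  define z where "z = 2 / (1 + mean_square)"
  have z: "1 < z" "0 \<le> z * mean_square" "z * mean_square < 1"
    using mean_square_nonneg mean_square_less_1 by (auto simp: z_def field_simps)
  \<comment> \<open>The first 1 counts the pairs of balls themselves, the inner 1 comes from the
    root, and the rest is the geometric series over the levels below it.\<close>
  define C where "C = 1 + (z - 1) * (1 + z * (s + 3)\<^sup>2 * (1 / (1 - z * mean_square)))"
  have "0 < C"
    using z by (auto simp: C_def intro!: add_pos_nonneg mult_nonneg_nonneg add_nonneg_nonneg)
  moreover have "(\<integral>\<^sup>+xs. ennreal (ancestor_moment z xs) \<partial>split_tree_law P V b s s0 s1 n)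
      \<le> ennreal (C * real n ^ 2)" for n
  proof -
    let ?L = "split_tree_law P V b s s0 s1 n"
    let ?f = "\<lambda>u xs. of_bool (internal xs u) * of_nat ((subtree_count xs u)\<^sup>2) :: ennreal"
    let ?g = "\<lambda>k. \<integral>\<^sup>+xs. (\<Sum>u\<in>level b k. ?f u xs) \<partial>?L"
    have "(\<integral>\<^sup>+xs. ennreal (ancestor_moment z xs) \<partial>?L) \<le> (\<integral>\<^sup>+xs. ennreal (real n ^ 2) + ennreal (z - 1) *
        (\<Sum>k. \<Sum>u\<in>level b k. ennreal (z ^ k) * ?f u xs) \<partial>?L)"
      using ancestor_moment_le_suminf z by (intro nn_integral_law_mono) auto
    also have "\<dots> = ennreal (real n ^ 2) + ennreal (z - 1) * (\<Sum>k. ennreal (z ^ k) * ?g k)"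
      by (simp add: nn_integral_add nn_integral_cmult nn_integral_suminf space_split_tree_law
          flip: sum_distrib_left)
    also have "(\<Sum>k. ennreal (z ^ k) * ?g k) = ?g 0 + (\<Sum>k. ennreal (z ^ Suc k) * ?g (Suc k))"
      by (subst suminf_offset[of _ 1]) auto
    also have "\<dots> \<le> ennreal (real n ^ 2) +
        (\<Sum>k. ennreal (z * (real n ^ 2 * (s + 3)\<^sup>2) * (z * mean_square) ^ k))"
    proof (intro add_mono suminf_le allI)
      have "?g 0 \<le> (\<integral>\<^sup>+xs. ennreal (real n ^ 2) \<partial>?L)"
      proof (rule nn_integral_law_mono)
        fix xs :: config assume "length xs = n"
        then have "subtree_count xs [] \<le> n"
          unfolding subtree_count_def using card_mono[of "{..<n}" "{j. j < length xs \<and> prefix [] (xs ! j)}"]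
          by auto
        then have "(subtree_count xs [])\<^sup>2 \<le> n\<^sup>2"
          by (rule power_mono) simp
        then have "real ((subtree_count xs [])\<^sup>2) \<le> real (n\<^sup>2)"
          by (rule of_nat_mono)
        then show "(\<Sum>u\<in>level b 0. ?f u xs) \<le> ennreal (real n ^ 2)"
          by (simp add: level_0 ennreal_of_nat_eq_real_of_nat ennreal_leI of_bool_def del: of_nat_power)
      qed
      then show "?g 0 \<le> ennreal (real n ^ 2)"
        by (simp add: space_split_tree_law)
      fix k
      have "ennreal (z ^ Suc k) * ?g (Suc k)
          \<le> ennreal (z ^ Suc k) * ennreal (real n ^ 2 * (s + 3)\<^sup>2 * mean_square ^ k)"
        by (intro mult_left_mono level_moment_le) auto
      also have "\<dots> = ennreal (z * (real n ^ 2 * (s + 3)\<^sup>2) * (z * mean_square) ^ k)"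
        using z by (simp add: ennreal_mult'[symmetric] power_mult_distrib mult_ac)
      finally show "ennreal (z ^ Suc k) * ?g (Suc k)
          \<le> ennreal (z * (real n ^ 2 * (s + 3)\<^sup>2) * (z * mean_square) ^ k)" .
    qed auto
    also have "(\<Sum>k. ennreal (z * (real n ^ 2 * (s + 3)\<^sup>2) * (z * mean_square) ^ k))
        = ennreal (z * (real n ^ 2 * (s + 3)\<^sup>2) * (1 / (1 - z * mean_square)))"
      using z by (intro suminf_ennreal_eq sums_mult geometric_sums) auto
    finally have "(\<integral>\<^sup>+xs. ennreal (ancestor_moment z xs) \<partial>?L)
        \<le> ennreal (real n ^ 2) + ennreal (z - 1) * (ennreal (real n ^ 2) +
          ennreal (z * (real n ^ 2 * (s + 3)\<^sup>2) * (1 / (1 - z * mean_square))))"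
      by (meson add_left_mono mult_left_mono order_trans zero_le)
    also have "\<dots> = ennreal (C * real n ^ 2)"
    proof -
      define D where "D = z * (s + 3)\<^sup>2 * (1 / (1 - z * mean_square))"
      have "0 \<le> D"
        using z by (simp add: D_def)
      moreover have "z * (real n ^ 2 * (s + 3)\<^sup>2) * (1 / (1 - z * mean_square)) = real n ^ 2 * D"
        by (simp add: D_def)
      moreover have "C * real n ^ 2 = real n ^ 2 + (z - 1) * (real n ^ 2 + real n ^ 2 * D)"
        by (simp add: C_def D_def algebra_simps)
      ultimately show ?thesis
        using z by (simp only: ennreal_plus ennreal_mult' zero_le_power of_nat_0_le_iff mult_nonneg_nonneg
            add_nonneg_nonneg diff_ge_0_iff_ge less_imp_le)
    qed
    finally show ?thesis .
  qed
  ultimately show ?thesis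
    using z(1) by blast
qed

end

section \<open>Acyclic digraphs\<close>

locale dag =
  fixes H :: "('v, 'e) pre_digraph"
  assumes acyclic: "acyclic_digraph H"
begin

sublocale digraph H
  using acyclic by (simp add: acyclic_digraph_def)

definition branching :: "'v set" where
  "branching = verts H - sinks H"

lemma reachable1_irrefl: "\<not> v \<rightarrow>\<^sup>+\<^bsub>H\<^esub> v"
proof
  assume "v \<rightarrow>\<^sup>+\<^bsub>H\<^esub> v"
  then obtain p where "awalk v p v" "p \<noteq> []"
    by (auto simp: reachable1_awalk)
  then have "closed_w p"
    by (auto simp: closed_w_def)
  then show False
    using closed_w_imp_cycle acyclic by (auto simp: acyclic_digraph_def)
qed

lemma mem_sinks_iff: "v \<in> sinks H \<longleftrightarrow> v \<in> verts H \<and> (\<forall>u. \<not> v \<rightarrow>\<^sup>+\<^bsub>H\<^esub> u)"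
proof -
  have "(\<forall>u. \<not> v \<rightarrow>\<^sup>+\<^bsub>H\<^esub> u) \<longleftrightarrow> (\<forall>u. \<not> v \<rightarrow>\<^bsub>H\<^esub> u)"
    by (meson r_into_trancl tranclD)
  also have "\<dots> \<longleftrightarrow> out_arcs H v = {}"
    unfolding arcs_ends_def arc_to_ends_def out_arcs_def image_iff by blast
  also have "\<dots> \<longleftrightarrow> out_degree H v = 0"
    by (simp add: out_degree_def card_eq_0_iff finite_out_arcs)
  finally show ?thesis
    by (auto simp: sinks_def)
qed

text \<open>Injectivity and the bound are required because the lower bound turns ranks into disjoint
  ranges of depths. The induction removes a vertex without descendants in the remaining set and
  gives it the top rank.\<close>

lemma topological_ranking:
  obtains \<rho> :: "'v \<Rightarrow> nat" where "inj_on \<rho> (verts H)" "\<And>v. v \<in> verts H \<Longrightarrow> \<rho> v < card (verts H)"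
    "\<And>u v. u \<rightarrow>\<^sup>+\<^bsub>H\<^esub> v \<Longrightarrow> \<rho> u < \<rho> v"
proof -
  have "\<exists>\<rho> :: 'v \<Rightarrow> nat. inj_on \<rho> A \<and> (\<forall>v\<in>A. \<rho> v < card A) \<and>
      (\<forall>u\<in>A. \<forall>v\<in>A. u \<rightarrow>\<^sup>+\<^bsub>H\<^esub> v \<longrightarrow> \<rho> u < \<rho> v)" if "finite A" for A
    using that
  proof (induction "card A" arbitrary: A)
    case (Suc k)
    have "wf (((arcs_ends H)\<^sup>+)\<inverse>)"
      unfolding trancl_converse[symmetric]
      by (intro wf_trancl finite_acyclic_wf_converse)
        (simp_all add: arcs_ends_def acyclic_def reachable1_irrefl[unfolded arcs_ends_def])
    note wf = this
    obtain x where "x \<in> A"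
      using Suc.hyps(2) by (cases "A = {}") auto
    then obtain m where m: "m \<in> A" "\<And>u. (u, m) \<in> ((arcs_ends H)\<^sup>+)\<inverse> \<Longrightarrow> u \<notin> A"
      using wfE_min[OF wf] by metis
    then have m': "\<not> m \<rightarrow>\<^sup>+\<^bsub>H\<^esub> u" if "u \<in> A" for u
      using that m(2)[of u] by blast
    have k: "card (A - {m}) = k" "finite (A - {m})"
      using Suc m(1) by auto
    obtain \<rho> :: "'v \<Rightarrow> nat" where \<rho>: "inj_on \<rho> (A - {m})" "\<forall>v\<in>A - {m}. \<rho> v < k"
      "\<forall>u\<in>A - {m}. \<forall>v\<in>A - {m}. u \<rightarrow>\<^sup>+\<^bsub>H\<^esub> v \<longrightarrow> \<rho> u < \<rho> v"
      using Suc.hyps(1)[OF k(1)[symmetric] k(2)] k(1) by auto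
    define \<rho>' where "\<rho>' = \<rho>(m := k)"
    have "inj_on \<rho>' A"
      using \<rho>(1,2) by (auto simp: \<rho>'_def inj_on_def)
    moreover have "\<forall>v\<in>A. \<rho>' v < card A"
      using \<rho>(2) Suc.hyps(2)[symmetric] by (auto simp: \<rho>'_def less_Suc_eq)
    moreover have "\<forall>u\<in>A. \<forall>v\<in>A. u \<rightarrow>\<^sup>+\<^bsub>H\<^esub> v \<longrightarrow> \<rho>' u < \<rho>' v"
      using \<rho>(2,3) m' by (auto simp: \<rho>'_def)
    ultimately show ?case by blast
  qed simp
  from this[OF finite_verts] show ?thesis
    using that reachable1_in_verts by metis
qed

lemma ex_sink_below:
  assumes "v \<in> branching"
  shows "\<exists>a\<in>sinks H. v \<rightarrow>\<^sup>+\<^bsub>H\<^esub> a"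
proof -
  obtain \<rho> :: "'v \<Rightarrow> nat" where \<rho>: "inj_on \<rho> (verts H)" "\<And>v. v \<in> verts H \<Longrightarrow> \<rho> v < card (verts H)"
    "\<And>u v. u \<rightarrow>\<^sup>+\<^bsub>H\<^esub> v \<Longrightarrow> \<rho> u < \<rho> v"
    using topological_ranking by blast
  show ?thesis
    using assms
  proof (induction "card (verts H) - \<rho> v" arbitrary: v rule: less_induct)
    case less
    obtain u where u: "v \<rightarrow>\<^sup>+\<^bsub>H\<^esub> u"
      using less.prems by (auto simp: branching_def mem_sinks_iff)
    show ?case
    proof (cases "u \<in> sinks H")
      case False
      then have "u \<in> branching"
        using u reachable1_in_verts by (auto simp: branching_def)
      moreover from this have "card (verts H) - \<rho> u < card (verts H) - \<rho> v"
        using \<rho>(2)[of u] \<rho>(3)[OF u] by (auto simp: branching_def)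
      ultimately show ?thesis
        using less.hyps u by (meson trancl_trans)
    qed (use u in blast)
  qed
qed

lemma finite_sinks [simp]: "finite (sinks H)" and finite_branching [simp]: "finite branching"
  by (auto simp: sinks_def branching_def)

lemma verts_eq: "verts H = sinks H \<union> branching" and sinks_disjoint: "sinks H \<inter> branching = {}"
  by (auto simp: sinks_def branching_def)

lemma ancestor_verts_eq:
  "ancestor_verts H = {v \<in> branching. card {a \<in> sinks H. v \<rightarrow>\<^sup>+\<^bsub>H\<^esub> a} = 1}"
  by (auto simp: ancestor_verts_def branching_def)

text \<open>Two sinks below a vertex suffice for the upper bound. Letting them coincide exactly for
  ancestor vertices allows both kinds of vertices to be estimated through
  \<open>common_depth\<close>.\<close>

lemma two_sinks:
  obtains \<sigma> \<tau> where "\<And>v. v \<in> branching \<Longrightarrow> \<sigma> v \<in> sinks H \<and> v \<rightarrow>\<^sup>+\<^bsub>H\<^esub> \<sigma> v"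
    "\<And>v. v \<in> branching \<Longrightarrow> \<tau> v \<in> sinks H \<and> v \<rightarrow>\<^sup>+\<^bsub>H\<^esub> \<tau> v"
    "ancestor_verts H = {v \<in> branching. \<sigma> v = \<tau> v}"
proof -
  let ?D = "\<lambda>v. {a \<in> sinks H. v \<rightarrow>\<^sup>+\<^bsub>H\<^esub> a}"
  have "\<exists>a a'. a \<in> ?D v \<and> a' \<in> ?D v \<and> (a = a' \<longleftrightarrow> card (?D v) = 1)" if v: "v \<in> branching" for v
  proof -
    obtain a where a: "a \<in> ?D v"
      using ex_sink_below[OF v] by blast
    show ?thesis
    proof (cases "card (?D v) = 1")
      case False
      then have "?D v \<noteq> {a}"
        by auto
      then obtain a' where "a' \<in> ?D v" "a \<noteq> a'"
        using a by blast
      then show ?thesis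
        using a False by blast
    qed (use a in blast)
  qed
  then have "\<forall>v\<in>branching. \<exists>p. fst p \<in> ?D v \<and> snd p \<in> ?D v \<and> (fst p = snd p \<longleftrightarrow> card (?D v) = 1)"
    by (intro ballI) (simp only: split_paired_Ex fst_conv snd_conv)
  from bchoice[OF this] obtain f where f: "\<forall>v\<in>branching. fst (f v) \<in> ?D v \<and> snd (f v) \<in> ?D v \<and>
      (fst (f v) = snd (f v) \<longleftrightarrow> card (?D v) = 1)" ..
  define \<sigma> \<tau> where "\<sigma> v = fst (f v)" and "\<tau> v = snd (f v)" for v
  have *: "\<And>v. v \<in> branching \<Longrightarrow> \<sigma> v \<in> ?D v"
    "\<And>v. v \<in> branching \<Longrightarrow> \<tau> v \<in> ?D v"
    "\<And>v. v \<in> branching \<Longrightarrow> \<sigma> v = \<tau> v \<longleftrightarrow> card (?D v) = 1"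
    unfolding \<sigma>_def \<tau>_def using f by blast+
  show ?thesis
  proof (rule that)
    show "ancestor_verts H = {v \<in> branching. \<sigma> v = \<tau> v}"
      unfolding ancestor_verts_eq by (intro Collect_cong conj_cong refl) (simp only: *(3))
  qed (use *(1,2) in blast)+
qed

end

section \<open>Counting embeddings from above\<close>

lemma card_common_ancestors_le:
  assumes "valid_config b s xs"
  shows "card {i. i < length xs \<and> strict_prefix (xs ! i) x \<and> strict_prefix (xs ! i) y}
    \<le> s * common_depth x y"
proof -
  let ?C = "{u. strict_prefix u x \<and> strict_prefix u y}"
  have fin: "finite ?C"
    by (rule finite_subset[OF _ finite_strict_prefixes[of x]]) auto
  have "{i. i < length xs \<and> strict_prefix (xs ! i) x \<and> strict_prefix (xs ! i) y}
      = (\<Union>u\<in>?C. balls_at xs u)"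
    by (auto simp: balls_at_def)
  then have "card {i. i < length xs \<and> strict_prefix (xs ! i) x \<and> strict_prefix (xs ! i) y}
      \<le> (\<Sum>u\<in>?C. card (balls_at xs u))"
    using card_UN_le[OF fin] by metis
  also have "\<dots> \<le> (\<Sum>u\<in>?C. s)"
    using assms by (intro sum_mono) (simp add: valid_config_def ball_count_def)
  finally show ?thesis
    by (simp add: common_depth_def mult.commute)
qed

text \<open>Injectivity and the relations among non-sinks are dropped. Once the sinks are placed,
  the other vertices can then be chosen separately, each among the common ancestors of two
  balls.\<close>

lemma (in dag) embedding_count_le:
  assumes xs: "valid_config b s xs"
    and \<sigma>: "\<And>v. v \<in> branching \<Longrightarrow> \<sigma> v \<in> sinks H \<and> v \<rightarrow>\<^sup>+\<^bsub>H\<^esub> \<sigma> v"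
    and \<tau>: "\<And>v. v \<in> branching \<Longrightarrow> \<tau> v \<in> sinks H \<and> v \<rightarrow>\<^sup>+\<^bsub>H\<^esub> \<tau> v"
  shows "embedding_count H xs \<le> (\<Sum>j\<in>sinks H \<rightarrow>\<^sub>E {..<length xs}.
    \<Prod>v\<in>branching. s * common_depth (xs ! j (\<sigma> v)) (xs ! j (\<tau> v)))"
proof -
  let ?n = "length xs"
  let ?anc = "\<lambda>x y. {i. i < ?n \<and> strict_prefix (xs ! i) x \<and> strict_prefix (xs ! i) y}"
  let ?T = "SIGMA j:sinks H \<rightarrow>\<^sub>E {..<?n}. \<Pi>\<^sub>E v\<in>branching. ?anc (xs ! j (\<sigma> v)) (xs ! j (\<tau> v))"
  let ?E = "{\<iota> \<in> verts H \<rightarrow>\<^sub>E {..<?n}. inj_on \<iota> (verts H) \<and>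
             (\<forall>u v. u \<rightarrow>\<^sup>+\<^bsub>H\<^esub> v \<longrightarrow> strict_prefix (xs ! \<iota> u) (xs ! \<iota> v))}"
  let ?\<Phi> = "\<lambda>\<iota>. (restrict \<iota> (sinks H), restrict \<iota> branching)"
  have fin: "finite ?T"
    by (intro finite_SigmaI finite_PiE) auto
  have "?\<Phi> ` ?E \<subseteq> ?T"
  proof
    fix p assume "p \<in> ?\<Phi> ` ?E"
    then obtain \<iota> where \<iota>: "\<iota> \<in> verts H \<rightarrow>\<^sub>E {..<?n}" "p = ?\<Phi> \<iota>"
      "\<And>u v. u \<rightarrow>\<^sup>+\<^bsub>H\<^esub> v \<Longrightarrow> strict_prefix (xs ! \<iota> u) (xs ! \<iota> v)"
      by auto
    have "\<iota> v < ?n" if "v \<in> verts H" for v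
      using \<iota>(1) that by auto
    then show "p \<in> ?T"
      using \<sigma> \<tau> \<iota>(3) by (auto simp: \<iota>(2) verts_eq)
  qed
  note sub = this
  have inj: "inj_on ?\<Phi> ?E"
  proof (rule inj_onI)
    fix \<iota> \<kappa> assume *: "\<iota> \<in> ?E" "\<kappa> \<in> ?E" "?\<Phi> \<iota> = ?\<Phi> \<kappa>"
    show "\<iota> = \<kappa>"
    proof (rule PiE_ext)
      show "\<iota> \<in> verts H \<rightarrow>\<^sub>E {..<?n}" "\<kappa> \<in> verts H \<rightarrow>\<^sub>E {..<?n}"
        using * by auto
      fix v assume "v \<in> verts H"
      then show "\<iota> v = \<kappa> v"
        using *(3) by (auto simp: verts_eq dest: fun_cong[of _ _ v])
    qed
  qed
  have "embedding_count H xs \<le> card ?T"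
    unfolding embedding_count_def by (rule card_inj_on_le[OF inj sub fin])
  also have "card ?T = (\<Sum>j\<in>sinks H \<rightarrow>\<^sub>E {..<?n}.
      \<Prod>v\<in>branching. card (?anc (xs ! j (\<sigma> v)) (xs ! j (\<tau> v))))"
    by (subst card_SigmaI) (simp_all add: card_PiE finite_PiE)
  also have "\<dots> \<le> (\<Sum>j\<in>sinks H \<rightarrow>\<^sub>E {..<?n}.
      \<Prod>v\<in>branching. s * common_depth (xs ! j (\<sigma> v)) (xs ! j (\<tau> v)))"
    by (intro sum_mono prod_mono conjI card_common_ancestors_le[OF xs]) auto
  finally show ?thesis .
qed

section \<open>Elementary inequalities for powers and products\<close>

lemma power_over_fact_le_exp:
  fixes x :: real
  assumes "0 \<le> x"
  shows "x ^ m / fact m \<le> exp x"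
proof -
  have "(\<Sum>k\<in>{m}. inverse (fact k) * x ^ k) \<le> (\<Sum>k. inverse (fact k) * x ^ k)"
    using assms by (intro sum_le_suminf summable_exp) auto
  also have "\<dots> = exp x"
    by (simp add: exp_def)
  finally show ?thesis
    by (simp add: field_simps)
qed

text \<open>The last bound is for the diagonal, where \<open>z ^ c\<close> has mean
  \<open>O(n)\<close> only. If \<open>exp (t * c)\<close> is at most \<open>n\<close>, then
  \<open>c\<close> is at most \<open>ln n / t\<close>. Otherwise one factor
  \<open>exp (t * c)\<close> of \<open>z ^ c\<close> exceeds \<open>n\<close>, and the other still
  dominates the power of \<open>c\<close>.\<close>

lemma power_le_exponential:
  fixes z :: real
  assumes z: "1 < z"
  obtains C where "0 \<le> C" "\<And>c. real c ^ m \<le> C * z ^ c"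
    "\<And>c n. 1 \<le> n \<Longrightarrow> real c ^ m \<le> C * (ln (real n) ^ m + z ^ c / real n)"
proof -
  \<comment> \<open>Half of \<open>ln z\<close> makes \<open>z ^ c\<close> the square of
    \<open>exp (t * c)\<close>: one factor absorbs the power of \<open>c\<close>, the other supplies
    the gain of \<open>n\<close>.\<close>
  define t where "t = ln z / 2"
  have t: "0 < t"
    using z by (simp add: t_def)
  define C where "C = fact m / t ^ m"
  have C: "0 \<le> C"
    using t by (simp add: C_def)
  have zc: "z ^ c = exp (t * c) * exp (t * c)" for c
  proof -
    have "z ^ c = exp (real c * ln z)"
      using z by (simp add: exp_of_nat_mult)
    then show ?thesis
      by (simp add: t_def mult.commute flip: exp_add)
  qed
  have 1: "real c ^ m \<le> C * exp (t * c)" for c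
  proof -
    have "(t * c) ^ m / fact m \<le> exp (t * c)"
      using t by (intro power_over_fact_le_exp) simp
    then show ?thesis
      using t by (simp add: C_def power_mult_distrib field_simps)
  qed
  have 2: "real c ^ m \<le> C * z ^ c" for c
  proof -
    have "exp (t * c) \<le> z ^ c"
      using t by (simp add: zc)
    then show ?thesis
      using 1[of c] C by (meson mult_left_mono order_trans)
  qed
  have 3: "real c ^ m \<le> C * (ln (real n) ^ m + z ^ c / real n)" if n: "1 \<le> n" for c n
  proof (cases "exp (t * c) \<le> real n")
    case True
    then have "t * c \<le> ln (real n)"
      using n by (simp add: ln_ge_iff)
    then have "(t * c) ^ m \<le> ln (real n) ^ m"
      using t by (intro power_mono) auto
    also have "\<dots> \<le> fact m * ln (real n) ^ m"
      using n by (intro mult_right_mono[of 1 "fact m", simplified]) auto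
    finally have "real c ^ m \<le> C * ln (real n) ^ m"
      using t by (simp add: C_def power_mult_distrib field_simps)
    also have "\<dots> \<le> C * (ln (real n) ^ m + z ^ c / real n)"
      using C z by (intro mult_left_mono) auto
    finally show ?thesis .
  next
    case False
    then have "exp (t * c) * real n \<le> z ^ c"
      unfolding zc by (intro mult_left_mono) auto
    then have "exp (t * c) \<le> z ^ c / real n"
      using n by (simp add: field_simps)
    also have "\<dots> \<le> ln (real n) ^ m + z ^ c / real n"
      using n by simp
    finally show ?thesis
      using 1[of c] C by (meson mult_left_mono order_trans)
  qed
  show ?thesis
    using that[OF C 2 3] .
qed

text \<open>The product is at most the power of its largest factor, and that power is one of the
  summands. Each term on the right involves one vertex only, so no joint moments arise.\<close>

lemma prod_le_sum_power_card:
  fixes y :: "'i \<Rightarrow> real"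
  assumes "finite B" "B \<noteq> {}" "\<And>v. v \<in> B \<Longrightarrow> 0 \<le> y v"
  shows "(\<Prod>v\<in>B. y v) \<le> (\<Sum>v\<in>B. y v ^ card B)"
proof -
  obtain v where v: "v \<in> B" "\<And>u. u \<in> B \<Longrightarrow> y u \<le> y v"
    using Max_in[of "y ` B"] Max_ge[of "y ` B"] assms(1,2) by fastforce
  have "(\<Prod>v\<in>B. y v) \<le> (\<Prod>u\<in>B. y v)"
    using assms v by (intro prod_mono) auto
  also have "\<dots> \<le> (\<Sum>v\<in>B. y v ^ card B)"
    using member_le_sum[of v B "\<lambda>v. y v ^ card B"] assms v(1) by simp
  finally show ?thesis .
qed

section \<open>Sums over all placements of the sinks\<close>

lemma sum_PiE_insert:
  assumes "a \<notin> A"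
  shows "(\<Sum>j\<in>insert a A \<rightarrow>\<^sub>E F. h j) = (\<Sum>i\<in>F. \<Sum>g\<in>A \<rightarrow>\<^sub>E F. h (g(a := i)))"
  unfolding PiE_insert_eq
  by (subst sum.reindex[OF inj_combinator[OF assms]]) (simp add: sum.cartesian_product split_def)

text \<open>Every coordinate other than \<open>a\<close> is free and contributes
  \<open>card F\<close>. The extra factor on the left avoids the exponent
  \<open>card A - 1\<close>.\<close>

lemma sum_PiE_one:
  fixes g :: "'i \<Rightarrow> real"
  assumes "finite A" "a \<in> A"
  shows "real (card F) * (\<Sum>j\<in>A \<rightarrow>\<^sub>E F. g (j a)) = real (card F) ^ card A * (\<Sum>i\<in>F. g i)"
proof -
  obtain A' where A: "A = insert a A'" "a \<notin> A'" "finite A'"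
    using assms by (metis finite_insert mk_disjoint_insert)
  have "(\<Sum>j\<in>A \<rightarrow>\<^sub>E F. g (j a)) = real (card F) ^ card A' * (\<Sum>i\<in>F. g i)"
    using A(2,3) by (simp add: A(1) sum_PiE_insert card_PiE sum_distrib_left sum_distrib_right mult.commute)
  then show ?thesis
    using A(2,3) by (simp add: A(1))
qed

lemma sum_PiE_two:
  fixes g :: "'i \<Rightarrow> 'i \<Rightarrow> real"
  assumes "finite A" "a \<in> A" "c \<in> A" "a \<noteq> c"
  shows "real (card F) ^ 2 * (\<Sum>j\<in>A \<rightarrow>\<^sub>E F. g (j a) (j c))
    = real (card F) ^ card A * (\<Sum>i\<in>F. \<Sum>k\<in>F. g i k)"
proof -
  define A' where "A' = A - {a, c}"
  have A: "A = insert a (insert c A')" "a \<notin> insert c A'" "c \<notin> A'" "finite A'"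
    using assms by (auto simp: A'_def)
  have "(\<Sum>j\<in>A \<rightarrow>\<^sub>E F. g (j a) (j c)) = real (card F) ^ card A' * (\<Sum>i\<in>F. \<Sum>k\<in>F. g i k)"
    using A(2-4) assms(4) not_sym[OF assms(4)]
    by (simp add: A(1) sum_PiE_insert card_PiE sum_distrib_left sum_distrib_right mult.commute)
  then show ?thesis
    using A(2-4) by (simp add: A(1) power2_eq_square)
qed

text \<open>
  A vertex with two sinks below it contributes a bounded factor on average, a vertex with a single
  sink below it a factor \<open>ln n\<close>. The factors are decoupled by bounding their product by a sum of
  powers.
\<close>

lemma (in dag) embedding_count_le_moment:
  assumes z: "1 < z"
  obtains K where "0 < K"
    "\<And>xs. valid_config b s xs \<Longrightarrow> 3 \<le> length xs \<Longrightarrow> real (embedding_count H xs) \<le>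
      K * (real (length xs) ^ card (sinks H) * ln (real (length xs)) ^ card (ancestor_verts H)) *
      (1 + ancestor_moment z xs / real (length xs) ^ 2)"
proof -
  obtain \<sigma> \<tau> where \<sigma>: "\<And>v. v \<in> branching \<Longrightarrow> \<sigma> v \<in> sinks H \<and> v \<rightarrow>\<^sup>+\<^bsub>H\<^esub> \<sigma> v"
    and \<tau>: "\<And>v. v \<in> branching \<Longrightarrow> \<tau> v \<in> sinks H \<and> v \<rightarrow>\<^sup>+\<^bsub>H\<^esub> \<tau> v"
    and A1: "ancestor_verts H = {v \<in> branching. \<sigma> v = \<tau> v}"
    using two_sinks by blast
  define m where "m = card branching"
  obtain C where C: "0 \<le> C" "\<And>c. real c ^ m \<le> C * z ^ c"
    "\<And>c n. 1 \<le> n \<Longrightarrow> real c ^ m \<le> C * (ln (real n) ^ m + z ^ c / real n)"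
    using power_le_exponential[OF z] by blast
  \<comment> \<open>The \<open>+ 1\<close> keeps \<open>K\<close> positive and makes it 1 if there
    are no branching vertices.\<close>
  define K where "K = real s ^ m * (m * C) + 1"
  have "0 < K"
    using C(1) by (simp add: K_def add_nonneg_pos)
  moreover have "real (embedding_count H xs) \<le>
      K * (real (length xs) ^ card (sinks H) * ln (real (length xs)) ^ card (ancestor_verts H)) *
      (1 + ancestor_moment z xs / real (length xs) ^ 2)"
    if xs: "valid_config b s xs" and n3: "3 \<le> length xs" for xs
  proof -
    let ?n = "length xs"
    let ?J = "sinks H \<rightarrow>\<^sub>E {..<?n}"
    let ?a0 = "card (sinks H)"
    let ?a1 = "card (ancestor_verts H)"
    define L where "L = ln (real ?n)"
    define \<Phi> where "\<Phi> = ancestor_moment z xs"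
    have n0: "0 < real ?n"
      using n3 unfolding of_nat_0_less_iff by linarith
    \<comment> \<open>This is where \<open>3 \<le> length xs\<close> is used: \<open>exp 1\<close>
      is at most 3.\<close>
    have L: "1 \<le> L"
    proof -
      have "exp 1 \<le> real ?n"
        using exp_le n3 by (simp add: order_trans)
      then show ?thesis
        by (simp add: L_def ln_ge_iff[OF n0])
    qed
    have \<Phi>: "0 \<le> \<Phi>"
      using z by (auto simp: \<Phi>_def ancestor_moment_def intro!: sum_nonneg)
    have bound: "real (embedding_count H xs) \<le>
        (\<Sum>j\<in>?J. \<Prod>v\<in>branching. real (s * common_depth (xs ! j (\<sigma> v)) (xs ! j (\<tau> v))))"
      using of_nat_mono[OF embedding_count_le[OF xs \<sigma> \<tau>], where 'a = real] by simp
    have one_le: "1 \<le> L ^ ?a1 * (1 + \<Phi> / real ?n ^ 2)"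
      using L \<Phi> mult_mono[of 1 "L ^ ?a1" 1 "1 + \<Phi> / real ?n ^ 2"] by (simp add: one_le_power)
    show ?thesis
    proof (cases "branching = {}")
      case True
      have "real (embedding_count H xs) \<le> real ?n ^ ?a0"
        using bound by (simp add: True card_PiE)
      also have "\<dots> \<le> real ?n ^ ?a0 * (L ^ ?a1 * (1 + \<Phi> / real ?n ^ 2))"
        using mult_left_mono[OF one_le, of "real ?n ^ ?a0"] by simp
      also have "\<dots> = K * (real ?n ^ ?a0 * L ^ ?a1) * (1 + \<Phi> / real ?n ^ 2)"
        by (simp add: K_def m_def True)
      finally show ?thesis
        by (simp add: L_def \<Phi>_def)
    next
      case False
      define d where "d j v = real (common_depth (xs ! j (\<sigma> v)) (xs ! j (\<tau> v)))" for j v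
      \<comment> \<open>The normalisation under which every factor has bounded moments; the product
        of the normalisers is the required power of the logarithm.\<close>
      define l where "l v = (if \<sigma> v = \<tau> v then L else 1)" for v
      have l: "0 < l v" "1 \<le> l v" for v
        using L by (auto simp: l_def)
      have prod_l: "(\<Prod>v\<in>branching. l v) = L ^ ?a1"
        by (simp add: l_def A1 prod.If_cases Int_def conj_commute)
      have S: "(\<Sum>j\<in>?J. (d j v / l v) ^ m) \<le> C * real ?n ^ ?a0 * (1 + \<Phi> / real ?n ^ 2)"
        if v: "v \<in> branching" for v
      proof (cases "\<sigma> v = \<tau> v")
        case True
        have n0: "0 < real ?n"
          using n3 by auto
        have "(d j v / l v) ^ m \<le> C * (1 + z ^ common_depth (xs ! j (\<sigma> v)) (xs ! j (\<sigma> v)) / real ?n)" for j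
        proof -
          let ?c = "common_depth (xs ! j (\<sigma> v)) (xs ! j (\<sigma> v))"
          have "real ?c ^ m \<le> C * (L ^ m + z ^ ?c / real ?n)"
            unfolding L_def using n3 by (intro C(3)) simp
          \<comment> \<open>Weakened so that \<open>L ^ m\<close> factors out and cancels against
            the normaliser.\<close>
          also have "\<dots> \<le> C * (L ^ m + L ^ m * (z ^ ?c / real ?n))"
          proof -
            have "1 * (z ^ ?c / real ?n) \<le> L ^ m * (z ^ ?c / real ?n)"
              using L z by (intro mult_right_mono one_le_power) auto
            then show ?thesis
              using C(1) by (intro mult_left_mono) auto
          qed
          finally have "real ?c ^ m \<le> L ^ m * (C * (1 + z ^ ?c / real ?n))"
            by (simp add: algebra_simps)
          then show ?thesis
            using L by (simp add: d_def l_def True power_divide pos_divide_le_eq mult.commute)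
        qed
        then have "(\<Sum>j\<in>?J. (d j v / l v) ^ m) \<le>
            (\<Sum>j\<in>?J. C * (1 + z ^ common_depth (xs ! j (\<sigma> v)) (xs ! j (\<sigma> v)) / real ?n))"
          by (rule sum_mono)
        also have "\<dots> = C * (real ?n ^ ?a0 +
            (\<Sum>j\<in>?J. z ^ common_depth (xs ! j (\<sigma> v)) (xs ! j (\<sigma> v))) / real ?n)"
          by (simp add: sum.distrib card_PiE sum_divide_distrib flip: sum_distrib_left)
        also have "(\<Sum>j\<in>?J. z ^ common_depth (xs ! j (\<sigma> v)) (xs ! j (\<sigma> v)))
            = real ?n ^ ?a0 * (\<Sum>i<?n. z ^ common_depth (xs ! i) (xs ! i)) / real ?n"
          using sum_PiE_one[of "sinks H" "\<sigma> v" "{..<?n}" "\<lambda>i. z ^ common_depth (xs ! i) (xs ! i)"]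
            \<sigma>[OF v] n0 by (simp add: field_simps)
        also have "C * (real ?n ^ ?a0 + real ?n ^ ?a0 * (\<Sum>i<?n. z ^ common_depth (xs ! i) (xs ! i)) / real ?n / real ?n)
            \<le> C * (real ?n ^ ?a0 + real ?n ^ ?a0 * \<Phi> / real ?n / real ?n)"
        proof (intro mult_left_mono add_left_mono divide_right_mono)
          \<comment> \<open>The sum over single balls is the diagonal of the double sum. Bounding it
            by the whole is affordable because the last estimate of
            \<open>power_le_exponential\<close> has already gained a factor
            \<open>1 / n\<close>.\<close>
          show "(\<Sum>i<?n. z ^ common_depth (xs ! i) (xs ! i)) \<le> \<Phi>"
            unfolding \<Phi>_def ancestor_moment_def using z
            by (intro sum_mono member_le_sum) auto
        qed (use C in auto)
        also have "\<dots> = C * real ?n ^ ?a0 * (1 + \<Phi> / real ?n ^ 2)"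
          by (simp add: algebra_simps power2_eq_square)
        finally show ?thesis .
      next
        case False
        have n0: "0 < real ?n ^ 2"
          using n3 by (intro zero_less_power) auto
        have "(\<Sum>j\<in>?J. (d j v / l v) ^ m) \<le>
            (\<Sum>j\<in>?J. C * z ^ common_depth (xs ! j (\<sigma> v)) (xs ! j (\<tau> v)))"
          using C(2) False by (intro sum_mono) (simp add: d_def l_def)
        also have "\<dots> = C * (\<Sum>j\<in>?J. z ^ common_depth (xs ! j (\<sigma> v)) (xs ! j (\<tau> v)))"
          by (simp add: sum_distrib_left)
        also have "(\<Sum>j\<in>?J. z ^ common_depth (xs ! j (\<sigma> v)) (xs ! j (\<tau> v)))
            = real ?n ^ ?a0 * \<Phi> / real ?n ^ 2"
          using sum_PiE_two[of "sinks H" "\<sigma> v" "\<tau> v" "{..<?n}" "\<lambda>i k. z ^ common_depth (xs ! i) (xs ! k)"]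
            \<sigma>[OF v] \<tau>[OF v] False n0 by (simp add: \<Phi>_def ancestor_moment_def field_simps)
        also have "C * (real ?n ^ ?a0 * \<Phi> / real ?n ^ 2) \<le> C * real ?n ^ ?a0 * (1 + \<Phi> / real ?n ^ 2)"
          using C(1) by (simp add: algebra_simps)
        finally show ?thesis .
      qed
      have "(\<Prod>v\<in>branching. real (s * common_depth (xs ! j (\<sigma> v)) (xs ! j (\<tau> v))))
          \<le> real s ^ m * L ^ ?a1 * (\<Sum>v\<in>branching. (d j v / l v) ^ m)" for j
      proof -
        have "(\<Prod>v\<in>branching. real (s * common_depth (xs ! j (\<sigma> v)) (xs ! j (\<tau> v))))
            = (\<Prod>v\<in>branching. real s * l v * (d j v / l v))"
          by (intro prod.cong refl) (simp add: d_def l(1)[THEN less_imp_neq, symmetric])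
        also have "\<dots> = real s ^ m * L ^ ?a1 * (\<Prod>v\<in>branching. d j v / l v)"
          by (simp only: prod.distrib prod_l prod_constant m_def)
        also have "\<dots> \<le> real s ^ m * L ^ ?a1 * (\<Sum>v\<in>branching. (d j v / l v) ^ m)"
          unfolding m_def using L l False
          by (intro mult_left_mono prod_le_sum_power_card) (auto simp: d_def less_imp_le)
        finally show ?thesis .
      qed
      then have "real (embedding_count H xs) \<le>
          (\<Sum>j\<in>?J. real s ^ m * L ^ ?a1 * (\<Sum>v\<in>branching. (d j v / l v) ^ m))"
        by (intro order_trans[OF bound] sum_mono)
      also have "\<dots> = real s ^ m * L ^ ?a1 * (\<Sum>v\<in>branching. \<Sum>j\<in>?J. (d j v / l v) ^ m)"
        by (subst sum.swap) (simp add: sum_distrib_left)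
      also have "\<dots> \<le> real s ^ m * L ^ ?a1 * (\<Sum>v\<in>branching. C * real ?n ^ ?a0 * (1 + \<Phi> / real ?n ^ 2))"
        using L by (intro mult_left_mono sum_mono S) auto
      also have "\<dots> = real s ^ m * (m * C) * (real ?n ^ ?a0 * L ^ ?a1 * (1 + \<Phi> / real ?n ^ 2))"
        by (simp add: m_def)
      also have "\<dots> \<le> K * (real ?n ^ ?a0 * L ^ ?a1 * (1 + \<Phi> / real ?n ^ 2))"
        using L \<Phi> by (intro mult_right_mono) (auto simp: K_def)
      finally show ?thesis
        by (simp add: L_def \<Phi>_def mult.assoc)
    qed
  qed
  ultimately show ?thesis
    using that by blast
qed

section \<open>Counting embeddings from below\<close>

lemma card_level: "card (level b k) = b ^ k"
  using card_lists_length_eq[of "{..<b}" k] by (simp add: level_def lists_eq_set conj_commute)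

lemma sum_power_less_power:
  fixes b :: nat
  assumes "2 \<le> b"
  shows "(\<Sum>k<D. b ^ k) \<le> b ^ D"
proof (induction D)
  case (Suc D)
  have "2 * b ^ D \<le> b * b ^ D"
    using assms by (rule mult_right_mono) simp
  with Suc show ?case
    unfolding sum.lessThan_Suc power_Suc by linarith
qed simp

lemma valid_config_nth: "valid_config b s xs \<Longrightarrow> j < length xs \<Longrightarrow> xs ! j \<in> lists {..<b}"
  using nth_mem[of j xs] unfolding valid_config_def by blast

lemma card_shallow_balls_le:
  assumes b: "2 \<le> b" and xs: "valid_config b s xs"
  shows "card {j. j < length xs \<and> length (xs ! j) < D} \<le> s * b ^ D"
proof -
  let ?U = "\<Union>k<D. level b k"
  have sub: "{j. j < length xs \<and> length (xs ! j) < D} \<subseteq> (\<Union>u\<in>?U. balls_at xs u)"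
  proof
    fix j assume j: "j \<in> {j. j < length xs \<and> length (xs ! j) < D}"
    then have "xs ! j \<in> lists {..<b}"
      using valid_config_nth[OF xs] by simp
    then show "j \<in> (\<Union>u\<in>?U. balls_at xs u)"
      using j by (auto simp: level_def balls_at_def)
  qed
  have "card {j. j < length xs \<and> length (xs ! j) < D} \<le> card (\<Union>u\<in>?U. balls_at xs u)"
    by (rule card_mono[OF _ sub]) auto
  also have "\<dots> \<le> (\<Sum>u\<in>?U. card (balls_at xs u))"
    by (rule card_UN_le) auto
  also have "\<dots> \<le> (\<Sum>u\<in>?U. s)"
    using xs by (intro sum_mono) (simp add: valid_config_def ball_count_def)
  also have "\<dots> = card ?U * s"
    by simp
  also have "card ?U \<le> (\<Sum>k<D. card (level b k))"
    by (rule card_UN_le) simp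
  also have "\<dots> \<le> b ^ D"
    using sum_power_less_power[OF b] by (simp add: card_level)
  finally show ?thesis
    by (simp add: mult.commute)
qed

text \<open>Pigeonhole over the nodes of depth \<open>M\<close>. Balls that agree on their first
  \<open>M\<close> levels have all ancestors of depth below \<open>M\<close> in common, which leaves
  room for vertices with several sinks below them.\<close>

lemma deep_subtree:
  assumes b: "2 \<le> b" and xs: "valid_config b s xs" and "M \<le> D"
  obtains w where "w \<in> level b M"
    "length xs - s * b ^ D \<le> b ^ M * card {j. j < length xs \<and> D \<le> length (xs ! j) \<and> take M (xs ! j) = w}"
proof -
  let ?n = "length xs"
  let ?T = "{j. j < ?n \<and> D \<le> length (xs ! j)}"
  let ?S = "\<lambda>w. {j. j < ?n \<and> D \<le> length (xs ! j) \<and> take M (xs ! j) = w}"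
  have "{..<?n} = {j. j < ?n \<and> length (xs ! j) < D} \<union> ?T"
    by auto
  then have "?n \<le> card {j. j < ?n \<and> length (xs ! j) < D} + card ?T"
    using card_Un_le[of "{j. j < ?n \<and> length (xs ! j) < D}" ?T] by (metis card_lessThan)
  then have T: "?n - s * b ^ D \<le> card ?T"
    using card_shallow_balls_le[OF b xs, of D] by simp
  have sub: "?T \<subseteq> (\<Union>w\<in>level b M. ?S w)"
  proof
    fix j assume j: "j \<in> ?T"
    then have "xs ! j \<in> lists {..<b}"
      using valid_config_nth[OF xs] by simp
    then have "take M (xs ! j) \<in> level b M"
      using j \<open>M \<le> D\<close> by (auto simp: level_def dest: in_set_takeD)
    then show "j \<in> (\<Union>w\<in>level b M. ?S w)"
      using j by blast
  qed
  have ne: "level b M \<noteq> {}"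
    using card_level[of b M] b by (metis card.empty not_numeral_le_zero power_not_zero)
  have "\<exists>w\<in>level b M. card ?T \<le> b ^ M * card (?S w)"
  proof (rule ccontr)
    assume "\<not> ?thesis"
    then have *: "b ^ M * card (?S w) < card ?T" if "w \<in> level b M" for w
      using that by (auto simp: not_le)
    have "card ?T \<le> card (\<Union>w\<in>level b M. ?S w)"
      by (rule card_mono[OF _ sub]) auto
    also have "\<dots> \<le> (\<Sum>w\<in>level b M. card (?S w))"
      by (rule card_UN_le) simp
    finally have "b ^ M * card ?T \<le> (\<Sum>w\<in>level b M. b ^ M * card (?S w))"
      by (simp flip: sum_distrib_left)
    also have "\<dots> < (\<Sum>w\<in>level b M. card ?T)"
      using * ne by (intro sum_strict_mono) auto
    finally show False
      by (simp add: card_level)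
  qed
  then show ?thesis
    using that T by (meson order_trans)
qed

text \<open>The number of injections is a falling factorial, each factor of which is at least
  \<open>card S - card A\<close>.\<close>

lemma card_inj_PiE_ge:
  assumes "finite A" "finite S"
  shows "(card S - card A) ^ card A \<le> card {j \<in> A \<rightarrow>\<^sub>E S. inj_on j A}"
proof -
  have "card {j \<in> A \<rightarrow>\<^sub>E S. inj_on j A} = (\<Prod>i = 0..<card A. card S - i)"
    using card_inj_on_subset_funcset[OF assms order_refl] by simp
  also have "\<dots> \<ge> (\<Prod>i = 0..<card A. card S - card A)"
    by (intro prod_mono) auto
  finally show ?thesis by simp
qed

context dag
begin

text \<open>The sinks below \<open>v\<close> are among those below \<open>u\<close>. So a vertex
  with several sinks below it never lies under an ancestor vertex, and all such vertices can be
  placed above all ancestor vertices.\<close>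

lemma sinks_below_ancestor:
  assumes "u \<in> ancestor_verts H" "u \<rightarrow>\<^sup>+\<^bsub>H\<^esub> v" "v \<in> branching"
  shows "v \<in> ancestor_verts H"
proof -
  let ?D = "\<lambda>v. {a \<in> sinks H. v \<rightarrow>\<^sup>+\<^bsub>H\<^esub> a}"
  have "?D v \<subseteq> ?D u"
    using assms(2) by (auto intro: trancl_trans)
  then have "card (?D v) \<le> card (?D u)"
    by (intro card_mono) auto
  moreover have "?D v \<noteq> {}"
    using ex_sink_below[OF assms(3)] by blast
  then have "0 < card (?D v)"
    unfolding card_gt_0_iff by simp
  moreover have "card (?D u) = 1"
    using assms(1) unfolding ancestor_verts_eq by blast
  ultimately have "card (?D v) = 1"
    by linarith
  then show ?thesis
    using assms(3) unfolding ancestor_verts_eq by blast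
qed

text \<open>
  Sinks go to balls \<open>j\<close> of depth at least \<open>D\<close> below \<open>w\<close>. Every other vertex goes to a node on the
  path to such a ball: a vertex with at least two sinks below it at depth \<open>\<rho> v\<close> (that is, above \<open>w\<close>),
  an ancestor vertex at one of \<open>L\<close> depths in a block that is determined by \<open>\<rho> v\<close>.
\<close>

lemma embedding_count_ge:
  fixes L :: nat
  assumes xs: "valid_config b s xs"
  defines "M \<equiv> card (verts H)"
  assumes D: "M + M * L \<le> D"
    and S: "\<And>j. j \<in> S \<Longrightarrow> j < length xs \<and> D \<le> length (xs ! j) \<and> take M (xs ! j) = w"
  shows "L ^ card (ancestor_verts H) * card {j \<in> sinks H \<rightarrow>\<^sub>E S. inj_on j (sinks H)}
    \<le> embedding_count H xs"
proof -
  let ?n = "length xs"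
  let ?A0 = "sinks H"
  let ?A1 = "ancestor_verts H"
  obtain \<rho> :: "'v \<Rightarrow> nat" where \<rho>: "inj_on \<rho> (verts H)" "\<And>v. v \<in> verts H \<Longrightarrow> \<rho> v < M"
    "\<And>u v. u \<rightarrow>\<^sup>+\<^bsub>H\<^esub> v \<Longrightarrow> \<rho> u < \<rho> v"
    using topological_ranking unfolding M_def by blast
  obtain \<sigma> where \<sigma>: "\<And>v. v \<in> branching \<Longrightarrow> \<sigma> v \<in> ?A0 \<and> v \<rightarrow>\<^sup>+\<^bsub>H\<^esub> \<sigma> v"
    using two_sinks by metis
  have A1_sub: "?A1 \<subseteq> branching"
    by (auto simp: ancestor_verts_eq)
  \<comment> \<open>The block of an ancestor vertex \<open>v\<close> consists of the
    \<open>L\<close> depths from \<open>M + \<rho> v * L\<close> on. Blocks are disjoint, increase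
    with the rank, and start at \<open>M\<close>, beyond all depths given to the other non-sinks.
    The offsets \<open>t\<close> are the free choices that produce the power of
    \<open>L\<close>.\<close>
  define dep where "dep t v = (if v \<in> ?A1 then M + \<rho> v * L + t v else \<rho> v)" for t v
  define node where "node t j v = take (dep t v) (xs ! j (\<sigma> v))" for t v and j :: "'v \<Rightarrow> nat"
  \<comment> \<open>The chosen nodes are internal, so validity provides a ball there.\<close>
  define pick where "pick u = (SOME i. i < ?n \<and> xs ! i = u)" for u
  define \<Psi> where "\<Psi> = (\<lambda>(t, j). \<lambda>v\<in>verts H. if v \<in> ?A0 then j v else pick (node t j v))"
  let ?P = "(?A1 \<rightarrow>\<^sub>E {..<L}) \<times> {j \<in> ?A0 \<rightarrow>\<^sub>E S. inj_on j ?A0}"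
  let ?E = "{\<iota> \<in> verts H \<rightarrow>\<^sub>E {..<?n}. inj_on \<iota> (verts H) \<and>
             (\<forall>u v. u \<rightarrow>\<^sup>+\<^bsub>H\<^esub> v \<longrightarrow> strict_prefix (xs ! \<iota> u) (xs ! \<iota> v))}"
  have branching_verts: "v \<in> verts H" if "v \<in> branching" for v
    using that by (simp add: verts_eq)
  have not_sink: "v \<notin> ?A0" if "v \<in> branching" for v
    using that sinks_disjoint by blast
  have main: "\<Psi> (t, j) \<in> ?E \<and> (\<forall>v\<in>branching. length (xs ! \<Psi> (t, j) v) = dep t v)"
    if t: "t \<in> ?A1 \<rightarrow>\<^sub>E {..<L}" and j: "j \<in> ?A0 \<rightarrow>\<^sub>E S" "inj_on j ?A0" for t j
  proof -
    define \<iota> where "\<iota> = \<Psi> (t, j)"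
    have \<iota>_sink: "\<iota> v = j v" if "v \<in> ?A0" for v
      using that by (simp add: \<iota>_def \<Psi>_def verts_eq)
    have \<iota>_br: "\<iota> v = pick (node t j v)" if "v \<in> branching" for v
      using that not_sink by (simp add: \<iota>_def \<Psi>_def verts_eq)
    have jS: "j a < ?n" "D \<le> length (xs ! j a)" "take M (xs ! j a) = w" if "a \<in> ?A0" for a
      using S[of "j a"] PiE_mem[OF j(1) that] by auto
    have dep_A1: "M + \<rho> v * L \<le> dep t v" "dep t v < M + Suc (\<rho> v) * L" if "v \<in> ?A1" for v
      using PiE_mem[OF t that] that by (auto simp: dep_def)
    have dep_less: "dep t v < D" if v: "v \<in> branching" for v
    proof (cases "v \<in> ?A1")
      case True
      have "Suc (\<rho> v) * L \<le> M * L"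
        using \<rho>(2)[OF branching_verts[OF v]] by (intro mult_right_mono) auto
      then show ?thesis
        using dep_A1(2)[OF True] D by linarith
    next
      case False
      then show ?thesis
        using \<rho>(2)[OF branching_verts[OF v]] D by (simp add: dep_def)
    qed
    have dep_mono: "dep t u < dep t v"
      if "u \<in> branching" "v \<in> branching" "\<rho> u < \<rho> v" "u \<in> ?A1 \<Longrightarrow> v \<in> ?A1" for u v
    proof (cases "u \<in> ?A1")
      case True
      have "Suc (\<rho> u) * L \<le> \<rho> v * L"
        using that(3) by (intro mult_right_mono) auto
      then show ?thesis
        using dep_A1(2)[OF True] dep_A1(1)[of v] that(4) True by linarith
    next
      case False
      then show ?thesis
        using that \<rho>(2)[OF branching_verts[OF that(1)]] dep_A1(1)[of v] by (cases "v \<in> ?A1") (auto simp: dep_def)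
    qed
    \<comment> \<open>The chosen node lies on the path to every sink ball below \<open>v\<close>,
      not only to that of \<open>\<sigma> v\<close>: an ancestor vertex has no other sink below it,
      and for the other vertices the depth is at most \<open>M\<close>, where all paths still follow
      \<open>w\<close>.\<close>
    have node_eq: "node t j v = take (dep t v) (xs ! j a)"
      if v: "v \<in> branching" and a: "a \<in> ?A0" "v \<rightarrow>\<^sup>+\<^bsub>H\<^esub> a" for v a
    proof (cases "v \<in> ?A1")
      case True
      then have "card {a \<in> ?A0. v \<rightarrow>\<^sup>+\<^bsub>H\<^esub> a} = 1"
        by (simp add: ancestor_verts_eq)
      then obtain c where c: "{a \<in> ?A0. v \<rightarrow>\<^sup>+\<^bsub>H\<^esub> a} = {c}"
        by (rule card_1_singletonE)
      have "a \<in> {a \<in> ?A0. v \<rightarrow>\<^sup>+\<^bsub>H\<^esub> a}" "\<sigma> v \<in> {a \<in> ?A0. v \<rightarrow>\<^sup>+\<^bsub>H\<^esub> a}"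
        using a \<sigma>[OF v] by simp_all
      then have "\<sigma> v = a"
        unfolding c by simp
      then show ?thesis
        by (simp add: node_def)
    next
      case False
      then have "dep t v \<le> M"
        using \<rho>(2)[OF branching_verts[OF v]] by (simp add: dep_def)
      then have "take (dep t v) x = take (dep t v) (take M x)" for x :: node
        by (simp add: min_absorb1)
      then show ?thesis
        unfolding node_def using jS(3)[of a] jS(3)[of "\<sigma> v"] \<sigma>[OF v] a by metis
    qed
    have node: "strict_prefix (node t j v) (xs ! j a)" "length (node t j v) = dep t v"
      if v: "v \<in> branching" and a: "a \<in> ?A0" "v \<rightarrow>\<^sup>+\<^bsub>H\<^esub> a" for v a
    proof -
      show len: "length (node t j v) = dep t v"
        using node_eq[OF v a] dep_less[OF v] jS(2)[OF a(1)] by simp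
      have "prefix (node t j v) (xs ! j a)"
        by (simp add: node_eq[OF v a] take_is_prefix)
      moreover have "node t j v \<noteq> xs ! j a"
        using len dep_less[OF v] jS(2)[OF a(1)] by auto
      ultimately show "strict_prefix (node t j v) (xs ! j a)"
        by (simp add: strict_prefix_def)
    qed
    have pick: "\<iota> v < ?n" "xs ! \<iota> v = node t j v" if v: "v \<in> branching" for v
    proof -
      have "internal xs (node t j v)"
        unfolding internal_iff using node(1)[OF v] \<sigma>[OF v] jS(1) nth_mem by blast
      then have "0 < ball_count xs (node t j v)"
        using xs by (simp add: valid_config_def)
      then have "\<exists>i. i < ?n \<and> xs ! i = node t j v"
        by (auto simp: ball_count_pos_iff in_set_conv_nth)
      from someI_ex[OF this] show "\<iota> v < ?n" "xs ! \<iota> v = node t j v"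
        by (simp_all add: \<iota>_br[OF v] pick_def)
    qed
    have len: "length (xs ! \<iota> v) = dep t v" if "v \<in> branching" for v
      using node(2)[OF that conjunct1[OF \<sigma>[OF that]] conjunct2[OF \<sigma>[OF that]]]
      by (simp only: pick(2)[OF that])
    have order: "strict_prefix (xs ! \<iota> u) (xs ! \<iota> v)" if uv: "u \<rightarrow>\<^sup>+\<^bsub>H\<^esub> v" for u v
    proof -
      have u: "u \<in> branching"
        using uv reachable1_in_verts(1)[OF uv] by (auto simp: branching_def mem_sinks_iff)
      show ?thesis
      proof (cases "v \<in> ?A0")
        case True
        then show ?thesis
          using node(1)[OF u True uv] by (simp add: pick(2)[OF u] \<iota>_sink)
      next
        case False
        then have v: "v \<in> branching"
          using reachable1_in_verts(2)[OF uv] by (simp add: branching_def)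
        obtain a where a: "a \<in> ?A0" "v \<rightarrow>\<^sup>+\<^bsub>H\<^esub> a"
          using ex_sink_below[OF v] by blast
        have ua: "u \<rightarrow>\<^sup>+\<^bsub>H\<^esub> a"
          using uv a(2) by (rule trancl_trans)
        have less: "dep t u < dep t v"
          using dep_mono[OF u v \<rho>(3)[OF uv]] sinks_below_ancestor[OF _ uv v] by blast
        have "node t j u = take (dep t u) (node t j v)"
          using less by (simp add: node_eq[OF u a(1) ua] node_eq[OF v a] min_absorb1)
        moreover have "node t j u \<noteq> node t j v"
          using less node(2)[OF u a(1) ua] node(2)[OF v a] by auto
        ultimately show ?thesis
          using take_is_prefix[of "dep t u" "node t j v"]
          by (simp add: pick(2)[OF u] pick(2)[OF v] strict_prefix_def)
      qed
    qed
    have inj: "inj_on \<iota> (verts H)"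
    proof (rule inj_onI)
      fix u v assume uv: "u \<in> verts H" "v \<in> verts H" "\<iota> u = \<iota> v"
      have mixed: False if "x \<in> ?A0" "y \<in> branching" "\<iota> x = \<iota> y" for x y
        using len[OF that(2)] dep_less[OF that(2)] jS(2)[OF that(1)] that(3) \<iota>_sink[OF that(1)] by simp
      consider "u \<in> ?A0" "v \<in> ?A0" | "u \<in> ?A0" "v \<in> branching" | "u \<in> branching" "v \<in> ?A0"
        | "u \<in> branching" "v \<in> branching"
        using uv(1,2) unfolding verts_eq by blast
      then show "u = v"
      proof cases
        case 1
        then show ?thesis
          using uv(3) j(2) \<iota>_sink by (simp add: inj_on_eq_iff)
      next
        case 2
        then show ?thesis using mixed uv(3) by blast
      next
        case 3
        then show ?thesis using mixed uv(3)[symmetric] by blast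
      next
        case 4
        then have eq: "dep t u = dep t v"
          using len uv(3) by metis
        \<comment> \<open>Depths determine ranks. The one case not covered by
          \<open>dep_mono\<close> is an ancestor vertex \<open>x\<close> and a non-ancestor
          \<open>y\<close>, and then \<open>x\<close> has depth at least \<open>M\<close> while
          \<open>y\<close> has depth below \<open>M\<close>.\<close>
        have "\<not> \<rho> x < \<rho> y" if "x \<in> branching" "y \<in> branching" "dep t x = dep t y" for x y
        proof
          assume "\<rho> x < \<rho> y"
          then have "x \<in> ?A1" "y \<notin> ?A1"
            using dep_mono[OF that(1,2)] that(3) by auto
          then show False
            using dep_A1(1)[of x] \<rho>(2)[OF branching_verts[OF that(2)]] that(3) by (simp add: dep_def)
        qed
        then have "\<rho> u = \<rho> v"
          using 4 eq by (metis linorder_neqE_nat)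
        then show ?thesis
          using \<rho>(1) uv(1,2) by (simp add: inj_on_eq_iff)
      qed
    qed
    have "\<iota> \<in> verts H \<rightarrow>\<^sub>E {..<?n}"
    proof (rule PiE_I)
      fix v assume "v \<in> verts H"
      then show "\<iota> v \<in> {..<?n}"
        using pick(1) jS(1) \<iota>_sink unfolding verts_eq by fastforce
    qed (simp add: \<iota>_def \<Psi>_def)
    then show ?thesis
      using inj order len unfolding \<iota>_def by blast
  qed
  have "inj_on \<Psi> ?P"
  proof (rule inj_onI)
    fix p p' assume p: "p \<in> ?P" "p' \<in> ?P" "\<Psi> p = \<Psi> p'"
    obtain t j t' j' where tj: "p = (t, j)" "p' = (t', j')"
      by (cases p, cases p') auto
    have t: "t \<in> ?A1 \<rightarrow>\<^sub>E {..<L}" "t' \<in> ?A1 \<rightarrow>\<^sub>E {..<L}"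
      and j: "j \<in> ?A0 \<rightarrow>\<^sub>E S" "inj_on j ?A0" "j' \<in> ?A0 \<rightarrow>\<^sub>E S" "inj_on j' ?A0"
      using p(1,2) by (auto simp: tj)
    have "j = j'"
    proof (rule PiE_ext[OF j(1,3)])
      fix a assume "a \<in> ?A0"
      then show "j a = j' a"
        using fun_cong[OF p(3), of a] by (simp add: tj \<Psi>_def verts_eq)
    qed
    moreover have "t = t'"
    proof (rule PiE_ext[OF t])
      fix v assume v: "v \<in> ?A1"
      \<comment> \<open>The embedding determines the depth of each ancestor vertex as the length of
        its node, and with it the offset.\<close>
      then have "dep t v = dep t' v"
        using main[OF t(1) j(1,2)] main[OF t(2) j(3,4)] p(3) A1_sub unfolding tj by (metis subsetD)
      then show "t v = t' v"
        using v by (simp add: dep_def)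
    qed
    ultimately show "p = p'"
      by (simp add: tj)
  qed
  moreover have "\<Psi> ` ?P \<subseteq> ?E"
  proof (rule image_subsetI)
    fix p assume "p \<in> ?P"
    then obtain t j where "p = (t, j)" "t \<in> ?A1 \<rightarrow>\<^sub>E {..<L}" "j \<in> ?A0 \<rightarrow>\<^sub>E S" "inj_on j ?A0"
      by blast
    then show "\<Psi> p \<in> ?E"
      using conjunct1[OF main] by simp
  qed
  moreover have "finite ?E"
    by (rule finite_subset[of _ "verts H \<rightarrow>\<^sub>E {..<?n}"]) (auto intro!: finite_PiE)
  ultimately have "card ?P \<le> embedding_count H xs"
    unfolding embedding_count_def by (rule card_inj_on_le)
  moreover have "finite ?A1"
    using finite_subset[OF A1_sub] by simp
  ultimately show ?thesis
    by (simp add: card_cartesian_product card_PiE)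
qed

lemma embedding_count_lower_bound:
  assumes b: "2 \<le> b" and ne: "verts H \<noteq> {}"
  obtains c where "0 < c" "\<forall>\<^sub>F n in sequentially. \<forall>xs. valid_config b s xs \<longrightarrow> length xs = n \<longrightarrow>
    c * real n ^ card (sinks H) * ln (real n) ^ card (ancestor_verts H) \<le> real (embedding_count H xs)"
proof -
  define M where "M = card (verts H)"
  have M: "0 < M"
    using ne by (simp add: M_def card_gt_0_iff)
  let ?a0 = "card (sinks H)"
  let ?a1 = "card (ancestor_verts H)"
  \<comment> \<open>Chosen so that depth at most \<open>\<delta> * ln n\<close> gives
    \<open>b ^ D\<close> at most \<open>sqrt n\<close>; then the balls above depth \<open>D\<close>
    number at most \<open>s * sqrt n\<close>, which is eventually below
    \<open>n / 2\<close>.\<close>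
  define \<delta> where "\<delta> = 1 / (2 * ln (real b))"
  have lnb: "0 < ln (real b)"
    using b by simp
  then have \<delta>: "0 < \<delta>"
    by (simp add: \<delta>_def)
  \<comment> \<open>At least \<open>n / (2 * b ^ M)\<close> balls are available for the sinks; half
    of this absorbs the loss from injectivity. Each ancestor vertex has at least
    \<open>\<delta> * ln n / (2 * M)\<close> depths.\<close>
  define c where "c = (1 / (4 * real b ^ M)) ^ ?a0 * (\<delta> / (2 * real M)) ^ ?a1"
  have "0 < c"
    using M \<delta> b by (simp add: c_def)
  have ln_top: "filterlim (\<lambda>n. ln (real n)) at_top sequentially"
    using ln_at_top filterlim_real_sequentially by (rule filterlim_compose)
  \<comment> \<open>The three thresholds absorb, in turn, the rounding in \<open>D\<close> and
    \<open>L\<close> together with the top \<open>M\<close> levels, the shallow balls, and the balls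
    lost to injectivity.\<close>
  have ev1: "\<forall>\<^sub>F n in sequentially. (real M * 2 + 1) * 2 / \<delta> \<le> ln (real n)"
    using ln_top by (simp add: filterlim_at_top)
  have ev2: "\<forall>\<^sub>F n in sequentially. (2 * real s) ^ 2 \<le> real n"
    using filterlim_real_sequentially by (simp add: filterlim_at_top)
  have ev3: "\<forall>\<^sub>F n in sequentially. 4 * real b ^ M * real ?a0 \<le> real n"
    using filterlim_real_sequentially by (simp add: filterlim_at_top)
  have "\<forall>\<^sub>F n in sequentially. \<forall>xs. valid_config b s xs \<longrightarrow> length xs = n \<longrightarrow>
    c * real n ^ ?a0 * ln (real n) ^ ?a1 \<le> real (embedding_count H xs)"
    using ev1 ev2 ev3 eventually_ge_at_top[of 1]
  proof eventually_elim
    case (elim n)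
    define D where "D = nat \<lfloor>\<delta> * ln (real n)\<rfloor>"
    \<comment> \<open>The largest block length for which \<open>M\<close> blocks fit between depths
      \<open>M\<close> and \<open>D\<close>.\<close>
    define L where "L = (D - M) div M"
    have n0: "0 < real n" and ln0: "0 \<le> ln (real n)"
      using elim(4) by auto
    have D_le: "real D \<le> \<delta> * ln (real n)" and D_ge: "\<delta> * ln (real n) - 1 \<le> real D"
      using \<delta> ln0 by (auto simp: D_def)
    have M2: "real M * 2 + 1 \<le> \<delta> * ln (real n) / 2"
      using elim(1) \<delta> by (simp add: field_simps)
    then have MD: "M \<le> D"
      using D_ge ln0 \<delta> by linarith
    have "M * L \<le> D - M"
      by (simp add: L_def)
    then have DL: "M + M * L \<le> D"
      using MD by linarith
    have L: "\<delta> / (2 * real M) * ln (real n) \<le> real L"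
    proof -
      have "D - M < M * (L + 1)"
        using M by (simp add: L_def dividend_less_times_div)
      then have "real D < real M * real L + real M * 2"
        using MD by (simp add: algebra_simps flip: of_nat_less_iff[where 'a = real])
      then have "\<delta> * ln (real n) / 2 \<le> real M * real L"
        using M2 D_ge by linarith
      then show ?thesis
        using M by (simp add: field_simps)
    qed
    have "real b ^ D = exp (real D * ln (real b))"
      using b by (simp add: exp_of_nat_mult)
    also have "\<dots> \<le> exp (\<delta> * ln (real n) * ln (real b))"
      using D_le lnb by simp
    also have "\<delta> * ln (real n) * ln (real b) = ln (sqrt (real n))"
      using lnb n0 by (simp add: \<delta>_def ln_sqrt)
    finally have bD: "real b ^ D \<le> sqrt (real n)"
      using n0 by simp
    have "real s * real b ^ D \<le> real n / 2"
    proof -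
      have "2 * real s \<le> sqrt (real n)"
        using elim(2) by (simp add: real_le_rsqrt)
      then have "2 * real s * real b ^ D \<le> sqrt (real n) * sqrt (real n)"
        using bD by (intro mult_mono) auto
      then show ?thesis by simp
    qed
    note shallow = this
    show ?case
    proof (intro allI impI)
      fix xs assume xs: "valid_config b s xs" and n: "length xs = n"
      obtain w where w: "length xs - s * b ^ D \<le>
          b ^ M * card {j. j < length xs \<and> D \<le> length (xs ! j) \<and> take M (xs ! j) = w}"
        using deep_subtree[OF b xs MD] by blast
      define S where "S = {j. j < length xs \<and> D \<le> length (xs ! j) \<and> take M (xs ! j) = w}"
      have "n \<le> s * b ^ D + b ^ M * card S"
        using w unfolding S_def[symmetric] unfolding n by linarith
      then have "real n \<le> real (s * b ^ D + b ^ M * card S)"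
        by (rule of_nat_mono)
      then have "real n / 2 \<le> real b ^ M * real (card S)"
        using shallow by simp
      then have "real n / 4 \<le> real b ^ M * (real (card S) - real ?a0)"
        using elim(3) by (simp add: algebra_simps)
      then have "1 / (4 * real b ^ M) * real n \<le> real (card S) - real ?a0"
        using b by (simp add: field_simps)
      also have "\<dots> \<le> real (card S - ?a0)"
        by simp
      finally have S: "1 / (4 * real b ^ M) * real n \<le> real (card S - ?a0)" .
      have "c * real n ^ ?a0 * ln (real n) ^ ?a1
          = (1 / (4 * real b ^ M) * real n) ^ ?a0 * (\<delta> / (2 * real M) * ln (real n)) ^ ?a1"
        unfolding c_def power_mult_distrib by (simp only: mult_ac)
      also have "\<dots> \<le> real (card S - ?a0) ^ ?a0 * real L ^ ?a1"
        using S L \<delta> ln0 by (intro mult_mono power_mono) auto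
      also have "\<dots> = real (L ^ ?a1 * (card S - ?a0) ^ ?a0)"
        by (simp add: mult.commute)
      also have "\<dots> \<le> real (L ^ ?a1 * card {j \<in> sinks H \<rightarrow>\<^sub>E S. inj_on j (sinks H)})"
        by (intro of_nat_mono mult_left_mono card_inj_PiE_ge) (auto simp: S_def)
      also have "\<dots> \<le> real (embedding_count H xs)"
        by (intro of_nat_mono embedding_count_ge[OF xs, of L D S w]) (use DL in \<open>auto simp: M_def S_def\<close>)
      finally show "c * real n ^ ?a0 * ln (real n) ^ ?a1 \<le> real (embedding_count H xs)" .
    qed
  qed
  with \<open>0 < c\<close> show ?thesis
    using that by blast
qed

end

section \<open>Embeddings into split trees\<close>

theorem theorem1p9:
  fixes H :: "('v, 'e) pre_digraph"
    and P :: "'a measure" and V :: "nat \<Rightarrow> 'a \<Rightarrow> real" and b s s0 s1 :: nat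
  assumes "acyclic_digraph H" and "verts H \<noteq> {}"
    and "split_tree P V b s s0 s1"
  shows "\<exists>c c' :: real. 0 < c \<and> 0 < c' \<and>
    (\<forall>\<^sub>F n in sequentially.
       (\<integral>\<^sup>+ xs. of_nat (embedding_count H xs) \<partial>split_tree_law P V b s s0 s1 n)
         \<le> ennreal (c * real n ^ card (sinks H) * ln (real n) ^ card (ancestor_verts H))) \<and>
    ((\<lambda>n. \<P>(xs in split_tree_law P V b s s0 s1 n.
            c' * real n ^ card (sinks H) * ln (real n) ^ card (ancestor_verts H)
              \<le> real (embedding_count H xs))) \<longlonglongrightarrow> 1)"
proof -
  interpret dag H
    by unfold_locales fact
  interpret split_tree P V b s s0 s1
    by fact
  let ?a0 = "card (sinks H)"
  let ?a1 = "card (ancestor_verts H)"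
  let ?law = "split_tree_law P V b s s0 s1"
  obtain c' where c': "0 < c'" "\<forall>\<^sub>F n in sequentially. \<forall>xs. valid_config b s xs \<longrightarrow> length xs = n \<longrightarrow>
    c' * real n ^ ?a0 * ln (real n) ^ ?a1 \<le> real (embedding_count H xs)"
    using embedding_count_lower_bound[OF b_ge_2 assms(2)] by blast
  have "(\<lambda>n. \<P>(xs in ?law n. c' * real n ^ ?a0 * ln (real n) ^ ?a1 \<le> real (embedding_count H xs)))
      \<longlonglongrightarrow> 1"
  proof (rule tendsto_eventually)
    show "\<forall>\<^sub>F n in sequentially. \<P>(xs in ?law n. c' * real n ^ ?a0 * ln (real n) ^ ?a1
        \<le> real (embedding_count H xs)) = 1"
      using c'(2)
    proof eventually_elim
      case (elim n)
      then show ?case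
        by (intro prob_split_tree_law_eq_1) blast
    qed
  qed
  moreover obtain z C where z: "1 < z" and C: "0 < C"
    "\<And>n. (\<integral>\<^sup>+xs. ennreal (ancestor_moment z xs) \<partial>?law n) \<le> ennreal (C * real n ^ 2)"
    using ancestor_moment_bound by blast
  obtain K where K: "0 < K"
    "\<And>xs. valid_config b s xs \<Longrightarrow> 3 \<le> length xs \<Longrightarrow> real (embedding_count H xs) \<le>
      K * (real (length xs) ^ ?a0 * ln (real (length xs)) ^ ?a1) *
      (1 + ancestor_moment z xs / real (length xs) ^ 2)"
    using embedding_count_le_moment[OF z] by blast
  \<comment> \<open>The factor \<open>1 + C\<close> bounds the mean of
    \<open>1 + ancestor_moment z xs / n^2\<close>.\<close>
  have "\<forall>\<^sub>F n in sequentially. (\<integral>\<^sup>+xs. of_nat (embedding_count H xs) \<partial>?law n)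
      \<le> ennreal (K * (1 + C) * real n ^ ?a0 * ln (real n) ^ ?a1)"
    using eventually_ge_at_top[of 3]
  proof eventually_elim
    case (elim n)
    define B where "B = K * (real n ^ ?a0 * ln (real n) ^ ?a1)"
    have n0: "0 < real n"
      using elim unfolding of_nat_0_less_iff by linarith
    have B: "0 \<le> B"
      using K(1) elim by (simp add: B_def)
    have "(\<integral>\<^sup>+xs. of_nat (embedding_count H xs) \<partial>?law n)
        \<le> (\<integral>\<^sup>+xs. ennreal B + ennreal (B / real n ^ 2) * ennreal (ancestor_moment z xs) \<partial>?law n)"
    proof (rule nn_integral_law_mono)
      fix xs assume xs: "valid_config b s xs" "length xs = n"
      have m: "0 \<le> ancestor_moment z xs"
        using z by (auto simp: ancestor_moment_def intro!: sum_nonneg)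
      have "real (embedding_count H xs) \<le> B + B / real n ^ 2 * ancestor_moment z xs"
        using K(2)[OF xs(1)] elim by (simp add: xs(2) B_def algebra_simps)
      then have "ennreal (real (embedding_count H xs)) \<le> ennreal (B + B / real n ^ 2 * ancestor_moment z xs)"
        by (rule ennreal_leI)
      also have "\<dots> = ennreal B + ennreal (B / real n ^ 2) * ennreal (ancestor_moment z xs)"
        using B m by (simp add: ennreal_plus ennreal_mult del: times_divide_eq_left)
      finally show "of_nat (embedding_count H xs)
          \<le> ennreal B + ennreal (B / real n ^ 2) * ennreal (ancestor_moment z xs)"
        by (simp add: ennreal_of_nat_eq_real_of_nat)
    qed
    also have "\<dots> = ennreal B + ennreal (B / real n ^ 2) * (\<integral>\<^sup>+xs. ennreal (ancestor_moment z xs) \<partial>?law n)"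
      by (simp add: nn_integral_add nn_integral_cmult space_split_tree_law)
    also have "\<dots> \<le> ennreal B + ennreal (B / real n ^ 2) * ennreal (C * real n ^ 2)"
      by (intro add_left_mono mult_left_mono C(2)) simp
    also have "\<dots> = ennreal (B + B / real n ^ 2 * (C * real n ^ 2))"
    proof -
      have "0 \<le> B / real n ^ 2" "0 \<le> C * real n ^ 2"
        using B C(1) by simp_all
      then show ?thesis
        by (simp only: ennreal_plus ennreal_mult B mult_nonneg_nonneg)
    qed
    also have "B + B / real n ^ 2 * (C * real n ^ 2) = K * (1 + C) * real n ^ ?a0 * ln (real n) ^ ?a1"
      using n0 by (simp add: B_def algebra_simps)
    finally show ?case .
  qed
  ultimately show ?thesis
    using c'(1) K(1) C(1) by (intro exI[of _ "K * (1 + C)"] exI[of _ c']) auto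
qed

end
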